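(* There exist a positive integer $n$ and a finite group $G$ of order $n$ such that $S_c(G)>S_c(C_n)$, where $C_n$ is the cyclic group of order $n$.
   Context: All groups are finite. $\mathrm{Irr}(G)$ denotes the set of complex irreducible characters of a finite group $G$. For $\chi\in\mathrm{Irr}(G)$, the codegree of $\chi$ is $\mathrm{cod}(\chi)=\frac{|G:\ker\chi|}{\chi(1)}$. The sum of codegrees is $S_c(G)=\sum_{\chi\in\mathrm{Irr}(G)}\mathrm{cod}(\chi)$. *)

theory Defs
  imports
    "HOL-Algebra.Coset"
    "HOL-Algebra.Elementary_Groups"
    "Jordan_Normal_Form.VS_Connect"
begin

definition GL :: "nat \<Rightarrow> complex mat monoid" where
  "GL d = units_of (ring_mat TYPE(complex) d ())"

definition representation :: "('a, 'b) monoid_scheme \<Rightarrow> nat \<Rightarrow> ('a \<Rightarrow> complex mat) \<Rightarrow> bool" where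
  "representation G d \<rho> \<longleftrightarrow> \<rho> \<in> hom G (GL d)"

definition irreducible_representation ::
    "('a, 'b) monoid_scheme \<Rightarrow> nat \<Rightarrow> ('a \<Rightarrow> complex mat) \<Rightarrow> bool" where
  "irreducible_representation G d \<rho> \<longleftrightarrow>
     representation G d \<rho> \<and> d > 0 \<and>
     (\<forall>W. VectorSpace.subspace class_ring W (module_vec TYPE(complex) d) \<and>
          (\<forall>g \<in> carrier G. \<forall>w \<in> W. \<rho> g *\<^sub>v w \<in> W)
          \<longrightarrow> W = {0\<^sub>v d} \<or> W = carrier_vec d)"

definition mat_trace :: "complex mat \<Rightarrow> complex" where
  "mat_trace A = (\<Sum>i<dim_row A. A $$ (i, i))"

(* Characters are restricted to the carrier (undefined outside it), so that two characters
   are equal as HOL functions exactly when they agree on G. *)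
definition character_of :: "('a, 'b) monoid_scheme \<Rightarrow> ('a \<Rightarrow> complex mat) \<Rightarrow> 'a \<Rightarrow> complex" where
  "character_of G \<rho> = (\<lambda>g \<in> carrier G. mat_trace (\<rho> g))"

definition Irr :: "('a, 'b) monoid_scheme \<Rightarrow> ('a \<Rightarrow> complex) set" where
  "Irr G = {character_of G \<rho> | d \<rho>. irreducible_representation G d \<rho>}"

definition char_kernel :: "('a, 'b) monoid_scheme \<Rightarrow> ('a \<Rightarrow> complex) \<Rightarrow> 'a set" where
  "char_kernel G \<chi> = {g \<in> carrier G. \<chi> g = \<chi> \<one>\<^bsub>G\<^esub>}"

(* For a character, \<chi>(1) is the degree, a positive integer; Re only changes its type. *)
definition cod :: "('a, 'b) monoid_scheme \<Rightarrow> ('a \<Rightarrow> complex) \<Rightarrow> real" where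
  "cod G \<chi> = real (card (rcosets\<^bsub>G\<^esub> (char_kernel G \<chi>))) / Re (\<chi> \<one>\<^bsub>G\<^esub>)"

(* Irr G is finite for finite G, so this is a genuine finite sum in that case. *)
definition S_c :: "('a, 'b) monoid_scheme \<Rightarrow> real" where
  "S_c G = (\<Sum>\<chi> \<in> Irr G. cod G \<chi>)"

end

theory Submission
  imports
    Defs
    "HOL-Library.Infinite_Set"
    "HOL-Computational_Algebra.Primes"
    "Jordan_Normal_Form.Spectral_Radius"
begin

text \<open>
  The sum of codegrees of the cyclic group of order n is the sum of n / gcd(j, n) over j < n, which
  is n^2 times the average of 1 / gcd(j, n). If n is divisible by every prime in a set P, this
  average is at most the product of 1 - 1/p + 1/p^2 over P, because a residue class is divisible
  by p with frequency 1/p, independently for distinct primes. As the sum of the reciprocals of the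
  primes diverges, this product can be made as small as one likes: a typical character of such a
  cyclic group is far from faithful (\<open>S_c_cyclic_le\<close>, \<open>sum_div_gcd_le\<close>,
  \<open>odd_prime_set_with_small_weight\<close>).

  The competing group replaces the line by a plane. Let m be the product of a set P of odd primes
  and let the group of signed 2 by 2 permutation matrices, which has order 8, act on (Z/m)^2.
  Modulo each p in P this action is irreducible. The character of the semidirect product that is
  induced from the linear character of (Z/m)^2 given by a vector u is therefore faithful as soon as
  u is nonzero modulo each p, and a random u violates this with probability at most the sum of
  1/p^2, which stays below 1/2 however large P is. Apart from a negligible set of u with nontrivial
  stabilizer, the induced character is also irreducible; it has degree 8 and hence codegree m^2.
  At least m^2/4 vectors qualify and at most 8 of them induce the same character. So the sum of
  codegrees is at least m^4/32, which is n^2/2048 for the group order n = 8 m^2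
  (\<open>S_c_semidirect_plane_ge\<close>). Choosing P such that the product above is below 1/2048 gives the
  claim.

  A lower bound for the sum over all irreducible characters by a sum over some of them requires
  that there are finitely many (\<open>finite_Irr\<close>): a sum over an infinite set is 0 by convention.
\<close>

section \<open>Products over primes and averages over residues\<close>

text \<open>
  Expanding each factor as a geometric series turns the product into the sum of 1/n over all n with
  all prime factors in P. The induction splits off the exact power of the new prime q from every
  element of S, which avoids infinite products.
\<close>
lemma sum_recip_smooth_le:
  fixes P S :: "nat set"
  assumes "finite P" "\<And>p. p \<in> P \<Longrightarrow> prime p"
    and "finite S" "\<And>n. n \<in> S \<Longrightarrow> n > 0" "\<And>n p. n \<in> S \<Longrightarrow> prime p \<Longrightarrow> p dvd n \<Longrightarrow> p \<in> P"
  shows "(\<Sum>n\<in>S. 1 / real n) \<le> (\<Prod>p\<in>P. 1 / (1 - 1 / real p))"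
  using assms
proof (induction P arbitrary: S rule: finite_induct)
  case empty
  have "S \<subseteq> {1}"
  proof
    fix n assume n: "n \<in> S"
    show "n \<in> {1}"
      using prime_factor_nat[of n] empty.prems(4)[OF n] by auto
  qed
  then have "(\<Sum>n\<in>S. 1 / real n) \<le> (\<Sum>n\<in>{1::nat}. 1 / real n)"
    by (intro sum_mono2) auto
  then show ?case by simp
next
  case (insert q P)
  have q: "prime q" using insert.prems(1) by simp
  then have q1: "q > 1" by (rule prime_gt_1_nat)
  define c where "c n = n div q ^ multiplicity q n" for n
  have dec: "n = q ^ multiplicity q n * c n" for n
    unfolding c_def by (simp add: multiplicity_dvd)
  define K where "K = Max (multiplicity q ` S)"
  have K: "multiplicity q n \<le> K" if "n \<in> S" for n
    unfolding K_def using that insert.prems(2) by (intro Max_ge) auto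
  have cpos: "c n > 0" if "n \<in> S" for n
    using dec[of n] insert.prems(3)[OF that] by (metis gr0I mult_0_right)
  have cq: "\<not> q dvd c n" if "n \<in> S" for n
    unfolding c_def using insert.prems(3)[OF that] q
    by (metis multiplicity_decompose not_prime_unit neq0_conv)
  have IH: "(\<Sum>n\<in>c ` S. 1 / real n) \<le> (\<Prod>p\<in>P. 1 / (1 - 1 / real p))"
  proof (rule insert.IH)
    show "prime p" if "p \<in> P" for p using insert.prems(1) that by simp
    show "finite (c ` S)" using insert.prems(2) by simp
    show "n > 0" if "n \<in> c ` S" for n using that cpos by auto
    show "p \<in> P" if n: "n \<in> c ` S" and p: "prime p" "p dvd n" for n p
    proof -
      obtain k where k: "k \<in> S" "n = c k" using n by auto
      have "p dvd k" using p(2) k(2) dec[of k] by (metis dvd_mult)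
      then have "p \<in> insert q P" using insert.prems(4) k(1) p(1) by blast
      moreover have "p \<noteq> q" using cq[OF k(1)] p(2) k(2) by auto
      ultimately show ?thesis by simp
    qed
  qed
  have "(\<Sum>n\<in>S. 1 / real n) \<le> (\<Sum>n\<in>(\<lambda>(i, k). q ^ i * k) ` ({..K} \<times> c ` S). 1 / real n)"
  proof (rule sum_mono2)
    show "finite ((\<lambda>(i, k). q ^ i * k) ` ({..K} \<times> c ` S))"
      using insert.prems(2) by auto
    show "S \<subseteq> (\<lambda>(i, k). q ^ i * k) ` ({..K} \<times> c ` S)"
    proof
      fix n assume n: "n \<in> S"
      show "n \<in> (\<lambda>(i, k). q ^ i * k) ` ({..K} \<times> c ` S)"
        using dec[of n] K[OF n] n by (intro image_eqI[of _ _ "(multiplicity q n, c n)"]) auto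
    qed
  qed auto
  also have "\<dots> \<le> (\<Sum>(i, k)\<in>{..K} \<times> c ` S. 1 / real (q ^ i * k))"
    using insert.prems(2)
    by (intro order_trans[OF sum_image_le]) (auto simp: case_prod_unfold)
  also have "\<dots> = (\<Sum>i\<le>K. (1 / real q) ^ i) * (\<Sum>k\<in>c ` S. 1 / real k)"
    by (simp add: sum_product sum.cartesian_product power_one_over)
  also have "(\<Sum>i\<le>K. (1 / real q) ^ i) \<le> 1 / (1 - 1 / real q)"
  proof -
    have "(\<Sum>i\<le>K. (1 / real q) ^ i) \<le> (\<Sum>i. (1 / real q) ^ i)"
      using q1 by (intro sum_le_suminf summable_geometric) auto
    also have "\<dots> = 1 / (1 - 1 / real q)"
      using q1 by (intro suminf_geometric) auto
    finally show ?thesis .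
  qed
  then have "(\<Sum>i\<le>K. (1 / real q) ^ i) * (\<Sum>k\<in>c ` S. 1 / real k)
      \<le> 1 / (1 - 1 / real q) * (\<Prod>p\<in>P. 1 / (1 - 1 / real p))"
    using q1 by (intro mult_mono IH) (auto intro!: sum_nonneg)
  finally show ?case using insert.hyps by simp
qed

lemma ln_Suc_le_harmonic_sum: "ln (real (Suc x)) \<le> (\<Sum>n\<in>{1..x}. 1 / real n)"
proof (induction x)
  case (Suc x)
  have "ln (real (Suc (Suc x))) = ln (real (Suc x) * (1 + 1 / real (Suc x)))"
    by (simp add: distrib_left del: of_nat_Suc)
  also have "\<dots> = ln (real (Suc x)) + ln (1 + 1 / real (Suc x))"
    by (intro ln_mult_pos add_pos_nonneg) auto
  also have "ln (1 + 1 / real (Suc x)) \<le> 1 / real (Suc x)"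
    by (rule ln_add_one_self_le_self) simp
  finally show ?case using Suc.IH by simp
qed simp

text \<open>
  All numbers up to x are composed of primes up to x, so the inverse of the product dominates the
  harmonic sum up to x, which is unbounded.
\<close>
lemma prod_prime_euler_factor_arbitrarily_small:
  fixes \<epsilon> :: real
  assumes "\<epsilon> > 0"
  shows "\<forall>\<^sub>F x in sequentially. (\<Prod>p | prime p \<and> p \<le> x. 1 - 1 / real p) < \<epsilon>"
proof -
  obtain N where N: "exp (1 / \<epsilon>) < real N" using reals_Archimedean2 by blast
  show ?thesis
    using eventually_ge_at_top[of N]
  proof eventually_elim
    case (elim x)
    let ?P = "{p. prime p \<and> p \<le> x}"
    have pos: "(\<Prod>p\<in>?P. 1 - 1 / real p) > 0"
      by (intro prod_pos) (auto dest: prime_gt_1_nat)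
    have "1 / \<epsilon> = ln (exp (1 / \<epsilon>))" by simp
    also have "\<dots> < ln (real (Suc x))" using N elim by (subst ln_less_cancel_iff) auto
    also have "\<dots> \<le> (\<Sum>n\<in>{1..x}. 1 / real n)" by (rule ln_Suc_le_harmonic_sum)
    also have "\<dots> \<le> (\<Prod>p\<in>?P. 1 / (1 - 1 / real p))"
      by (rule sum_recip_smooth_le) (auto dest: dvd_imp_le)
    also have "\<dots> = 1 / (\<Prod>p\<in>?P. 1 - 1 / real p)"
      by (simp add: prod_dividef)
    finally have "1 / \<epsilon> < 1 / (\<Prod>p\<in>?P. 1 - 1 / real p)" .
    then show ?case using pos assms by (simp add: field_simps)
  qed
qed

lemma sum_dvd_dilate:
  fixes N q :: nat and f :: "nat \<Rightarrow> real"
  assumes "q dvd N" "q > 0"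
  shows "(\<Sum>k<N. if q dvd k then f k else 0) = (\<Sum>k<N div q. f (q * k))"
proof -
  have "(\<Sum>k<N. if q dvd k then f k else 0) = (\<Sum>k\<in>{k \<in> {..<N}. q dvd k}. f k)"
    by (rule sum.inter_filter[symmetric]) simp
  also have "\<dots> = (\<Sum>k<N div q. f (q * k))"
    using assms
    by (intro sum.reindex_bij_witness[of _ "\<lambda>k. q * k" "\<lambda>k. k div q"]) (auto elim!: dvdE)
  finally show ?thesis .
qed

lemma card_multiples_below:
  fixes N q :: nat
  assumes "q dvd N" "q > 0"
  shows "card {k. k < N \<and> q dvd k} = N div q"
proof -
  have "bij_betw (\<lambda>k. q * k) {..<N div q} {k. k < N \<and> q dvd k}"
    using assms by (intro bij_betwI[where g="\<lambda>k. k div q"]) (auto elim!: dvdE)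
  then show ?thesis by (metis bij_betw_same_card card_lessThan)
qed

text \<open>
  The events \<open>p dvd k\<close> are independent when k ranges over a full period. Adding a prime q to P changes
  the weight only at the multiples of q, and there the weight for P at q k equals the weight at k,
  so the induction hypothesis applies once to N and once to N div q. This is why N is arbitrary and
  not the product of P itself.
\<close>
lemma sum_prod_prime_weights:
  fixes P :: "nat set" and N :: nat
  assumes "finite P" "\<And>p. p \<in> P \<Longrightarrow> prime p" "\<Prod>P dvd N"
  shows "(\<Sum>k<N. \<Prod>p\<in>P. if p dvd k then 1 / real p else 1)
         = real N * (\<Prod>p\<in>P. 1 - 1 / real p + 1 / real p ^ 2)"
  using assms
proof (induction P arbitrary: N rule: finite_induct)
  case (insert q P)
  define w where "w k = (\<Prod>p\<in>P. if p dvd k then 1 / real p else 1)" for k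
  have q: "prime q" using insert.prems(1) by simp
  then have q0: "q > 0" by (rule prime_gt_0_nat)
  have qN: "q dvd N" using insert.prems(2) insert.hyps by (auto dest: dvd_mult_left)
  have PN: "\<Prod>P dvd N" using insert.prems(2) insert.hyps by (auto dest: dvd_mult_right)
  have PNq: "\<Prod>P dvd N div q"
    using insert.prems(2) insert.hyps q0 qN by (metis dvd_mult_div_cancel finite_insert
        nat_mult_dvd_cancel_disj neq0_conv prod.insert)
  have w: "w (q * k) = w k" for k
    unfolding w_def
  proof (intro prod.cong refl)
    fix p assume p: "p \<in> P"
    then have "prime p" "p \<noteq> q" using insert.prems(1) insert.hyps by auto
    then have "p dvd q * k \<longleftrightarrow> p dvd k"
      using q by (metis prime_dvd_mult_iff primes_dvd_imp_eq)
    then show "(if p dvd q * k then 1 / real p else 1) = (if p dvd k then 1 / real p else 1)" by simp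
  qed
  have IH: "(\<Sum>k<M. w k) = real M * (\<Prod>p\<in>P. 1 - 1 / real p + 1 / real p ^ 2)" if "\<Prod>P dvd M" for M
    unfolding w_def using insert.IH[of M] insert.prems(1) that by auto
  have "(\<Sum>k<N. \<Prod>p\<in>insert q P. if p dvd k then 1 / real p else 1)
      = (\<Sum>k<N. w k - (1 - 1 / real q) * (if q dvd k then w k else 0))"
    using insert.hyps by (intro sum.cong) (auto simp: w_def algebra_simps)
  also have "\<dots> = (\<Sum>k<N. w k) - (1 - 1 / real q) * (\<Sum>k<N div q. w k)"
    using sum_dvd_dilate[OF qN q0, of w] w by (simp add: sum_subtractf flip: sum_distrib_left)
  also have "\<dots> = (real N - (1 - 1 / real q) * real (N div q)) * (\<Prod>p\<in>P. 1 - 1 / real p + 1 / real p ^ 2)"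
    by (simp add: IH PN PNq algebra_simps)
  also have "real N - (1 - 1 / real q) * real (N div q) = real N * (1 - 1 / real q + 1 / real q ^ 2)"
    using qN q0 by (simp add: real_of_nat_div field_simps power2_eq_square)
  finally show ?case using insert.hyps by simp
qed simp

lemma prod_primes_dvd:
  fixes Q :: "nat set" and n :: nat
  assumes "finite Q" "\<And>p. p \<in> Q \<Longrightarrow> prime p" "\<And>p. p \<in> Q \<Longrightarrow> p dvd n"
  shows "\<Prod>Q dvd n"
  using assms
proof (induction Q rule: finite_induct)
  case (insert q Q)
  have "coprime q (\<Prod>Q)"
    using insert by (intro prod_coprime_right primes_coprime) auto
  then show ?case using insert by (simp add: divides_mult)
qed simp

text \<open>
  The primes of P dividing j all divide gcd j n, so 1 / gcd j n is at most the weight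
  whose sum \<open>sum_prod_prime_weights\<close> evaluates.
\<close>
lemma sum_div_gcd_le:
  fixes P :: "nat set" and n :: nat
  assumes "finite P" "\<And>p. p \<in> P \<Longrightarrow> prime p" "\<Prod>P dvd n" "n > 0"
  shows "(\<Sum>j<n. real n / real (gcd j n)) \<le> real n ^ 2 * (\<Prod>p\<in>P. 1 - 1 / real p + 1 / real p ^ 2)"
proof -
  have "real n / real (gcd j n) \<le> real n * (\<Prod>p\<in>P. if p dvd j then 1 / real p else 1)" for j
  proof -
    let ?Q = "{p \<in> P. p dvd j}"
    have "\<Prod>?Q dvd \<Prod>P" using assms(1) by (intro prod_dvd_prod_subset) auto
    moreover have "\<Prod>?Q dvd j"
      using assms by (intro prod_primes_dvd) auto
    ultimately have "\<Prod>?Q dvd gcd j n" using assms(3) by (meson dvd_trans gcd_greatest)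
    then have "\<Prod>?Q \<le> gcd j n" using assms(4) by (intro dvd_imp_le) auto
    moreover have pos: "\<Prod>?Q > 0" using assms(2) by (intro prod_pos) (auto dest: prime_gt_0_nat)
    ultimately have "1 / real (gcd j n) \<le> 1 / real (\<Prod>?Q)"
      by (intro divide_left_mono) (auto simp: assms(4) simp flip: of_nat_prod)
    also have "\<dots> = (\<Prod>p\<in>?Q. 1 / real p)" by (simp add: prod_dividef)
    also have "\<dots> = (\<Prod>p\<in>P. if p dvd j then 1 / real p else 1)"
      using assms(1) by (simp add: prod.inter_filter)
    finally show ?thesis using mult_left_mono[of _ _ "real n"] by fastforce
  qed
  then have "(\<Sum>j<n. real n / real (gcd j n))
      \<le> (\<Sum>j<n. real n * (\<Prod>p\<in>P. if p dvd j then 1 / real p else 1))"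
    by (intro sum_mono)
  also have "\<dots> = real n ^ 2 * (\<Prod>p\<in>P. 1 - 1 / real p + 1 / real p ^ 2)"
    using sum_prod_prime_weights[OF assms(1-3)]
    by (simp add: power2_eq_square flip: sum_distrib_left)
  finally show ?thesis .
qed

text \<open>
  For t at most 1/3 the square of 1 - t + t^2 is at most 1 - t, so the square of this product is
  bounded by the product of 1 - 1/p. The prime 2 only contributes a factor 1/2 to the latter.
\<close>
lemma odd_prime_set_with_small_weight:
  fixes \<epsilon> :: real
  assumes "\<epsilon> > 0"
  obtains P :: "nat set" where "finite P" "\<And>p. p \<in> P \<Longrightarrow> prime p \<and> odd p" "\<Prod>P \<ge> 17"
    "(\<Prod>p\<in>P. 1 - 1 / real p + 1 / real p ^ 2) < \<epsilon>"
proof -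
  have "\<forall>\<^sub>F x in sequentially. (\<Prod>p | prime p \<and> p \<le> x. 1 - 1 / real p) < \<epsilon>\<^sup>2 / 2"
    using assms by (intro prod_prime_euler_factor_arbitrarily_small) simp
  then obtain N where N: "\<And>x. x \<ge> N \<Longrightarrow> (\<Prod>p | prime p \<and> p \<le> x. 1 - 1 / real p) < \<epsilon>\<^sup>2 / 2"
    by (auto simp: eventually_sequentially)
  define x where "x = max N 17"
  have x: "(\<Prod>p | prime p \<and> p \<le> x. 1 - 1 / real p) < \<epsilon>\<^sup>2 / 2" "x \<ge> 17"
    using N[of x] by (auto simp: x_def)
  define P where "P = {p. prime p \<and> p \<le> x} - {2}"
  have P: "prime p \<and> odd p" if "p \<in> P" for p
    using that unfolding P_def by (metis DiffD1 DiffD2 insertCI mem_Collect_eq primes_dvd_imp_eq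
        two_is_prime_nat)
  have fin: "finite P" unfolding P_def by simp
  have ge3: "p \<ge> 3" if "p \<in> P" for p
    using P[OF that] by (metis One_nat_def Suc_leI eval_nat_numeral(3) le_neq_implies_less odd_one
        prime_ge_2_nat dvd_refl)
  \<comment> \<open>A single prime in P bounds the product of P from below.\<close>
  have "prime (17::nat)" by simp
  then have "17 \<in> P" using x(2) by (simp add: P_def)
  then have "17 dvd \<Prod>P" using fin by (intro dvd_prodI) auto
  moreover have "\<Prod>P > 0" using P by (intro prod_pos) (auto dest: prime_gt_0_nat)
  ultimately have "\<Prod>P \<ge> 17" by (intro dvd_imp_le)
  moreover have "(\<Prod>p\<in>P. 1 - 1 / real p + 1 / real p ^ 2) < \<epsilon>"
  proof -
    have "(1 - 1 / real p + 1 / real p ^ 2) ^ 2 \<le> 1 - 1 / real p" if "p \<in> P" for p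
    proof -
      define t where "t = 1 / real p"
      have t: "0 < t" "t \<le> 1 / 3" using ge3[OF that] by (auto simp: t_def field_simps)
      have "(1 - t + t\<^sup>2)\<^sup>2 = (1 - t) - t * (1 - 3 * t + t\<^sup>2 * (2 - t))"
        by (simp add: power2_eq_square algebra_simps)
      also have "\<dots> \<le> 1 - t"
      proof -
        have "0 \<le> t\<^sup>2 * (2 - t)" using t by (intro mult_nonneg_nonneg) auto
        then show ?thesis using t by simp
      qed
      finally show ?thesis by (simp add: t_def power_one_over)
    qed
    then have "(\<Prod>p\<in>P. 1 - 1 / real p + 1 / real p ^ 2) ^ 2 \<le> (\<Prod>p\<in>P. 1 - 1 / real p)"
      unfolding prod_power_distrib by (intro prod_mono) auto
    also have "\<dots> = 2 * (\<Prod>p | prime p \<and> p \<le> x. 1 - 1 / real p)"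
      using x(2) unfolding P_def by (subst prod.remove[of "{p. prime p \<and> p \<le> x}" 2]) auto
    also have "\<dots> < \<epsilon>\<^sup>2" using x(1) by simp
    finally show ?thesis using assms by (simp add: power2_less_imp_less)
  qed
  ultimately show thesis using that P fin by blast
qed

text \<open>
  Comparison with the telescoping sum of 1/(k-1) - 1/k from k = 3.
\<close>
lemma sum_recip_squares_ge_3:
  fixes P :: "nat set"
  assumes "finite P" "\<And>p. p \<in> P \<Longrightarrow> p \<ge> 3"
  shows "(\<Sum>p\<in>P. 1 / real p ^ 2) \<le> 1 / 2"
proof -
  have tel: "(\<Sum>p\<in>{3..<3 + K}. 1 / real p ^ 2) \<le> 1 / 2 - 1 / real (2 + K)" for K
  proof (induction K)
    case (Suc K)
    have "1 / real (3 + K) ^ 2 \<le> 1 / real (2 + K) - 1 / real (3 + K)"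
      by (simp add: divide_simps power2_eq_square) (simp add: algebra_simps)?
    moreover have "{3..<3 + Suc K} = insert (3 + K) {3..<3 + K}" by auto
    ultimately show ?case using Suc by (simp add: add.commute add.left_commute)
  qed simp
  obtain K where K: "P \<subseteq> {..<K}" using assms(1) finite_nat_iff_bounded by blast
  have "(\<Sum>p\<in>P. 1 / real p ^ 2) \<le> (\<Sum>p\<in>{3..<3 + K}. 1 / real p ^ 2)"
    using K assms(2) by (intro sum_mono2) force+
  also have "\<dots> \<le> 1 / 2" by (rule order_trans[OF tel]) simp
  finally show ?thesis .
qed

text \<open>
  Union bound over P: a fraction 1/p^2 of the pairs is divisible by p, and these fractions add up to
  at most 1/2.
\<close>
lemma card_pairs_without_common_prime:
  fixes P :: "nat set"
  assumes fin: "finite P" and P: "\<And>p. p \<in> P \<Longrightarrow> prime p \<and> odd p"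
  defines "m \<equiv> \<Prod>P"
  shows "real m ^ 2 / 2 \<le> real (card {(x, y). x < m \<and> y < m \<and> (\<forall>p\<in>P. \<not> (p dvd x \<and> p dvd y))})"
proof -
  let ?M = "\<lambda>p. {k. k < m \<and> p dvd k}"
  let ?U = "{(x, y). x < m \<and> y < m \<and> (\<forall>p\<in>P. \<not> (p dvd x \<and> p dvd y))}"
  have fU: "finite ?U" by (rule finite_subset[of _ "{..<m} \<times> {..<m}"]) auto
  have "{..<m} \<times> {..<m} \<subseteq> ?U \<union> (\<Union>p\<in>P. ?M p \<times> ?M p)" by auto
  then have "card ({..<m} \<times> {..<m}) \<le> card (?U \<union> (\<Union>p\<in>P. ?M p \<times> ?M p))"
    using fU fin by (intro card_mono) auto
  also have "\<dots> \<le> card ?U + (\<Sum>p\<in>P. card (?M p \<times> ?M p))"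
    by (intro order_trans[OF card_Un_le] add_left_mono card_UN_le fin)
  finally have "real (m * m) \<le> real (card ?U + (\<Sum>p\<in>P. card (?M p \<times> ?M p)))"
    by (simp only: of_nat_le_iff card_cartesian_product card_lessThan)
  moreover have "real (card (?M p \<times> ?M p)) = real m ^ 2 * (1 / real p ^ 2)" if "p \<in> P" for p
  proof -
    have "p dvd m" unfolding m_def using that fin by (rule dvd_prodI[rotated])
    then show ?thesis
      using P[OF that] card_multiples_below[of p m]
      by (simp add: card_cartesian_product prime_gt_0_nat real_of_nat_div power2_eq_square)
  qed
  ultimately have "real m ^ 2 \<le> real (card ?U) + real m ^ 2 * (\<Sum>p\<in>P. 1 / real p ^ 2)"
    by (simp add: sum_distrib_left power2_eq_square)
  also have "real m ^ 2 * (\<Sum>p\<in>P. 1 / real p ^ 2) \<le> real m ^ 2 * (1 / 2)"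
  proof (intro mult_left_mono sum_recip_squares_ge_3 fin)
    show "p \<ge> 3" if "p \<in> P" for p
      using P[OF that] by (metis One_nat_def Suc_leI eval_nat_numeral(3) le_neq_implies_less odd_one
          prime_ge_2_nat dvd_refl)
  qed auto
  finally show ?thesis by simp
qed

section \<open>Representations and the finiteness of the set of irreducible characters\<close>

lemma subspace_vec_iff:
  "VectorSpace.subspace class_ring W (module_vec TYPE(complex) d) \<longleftrightarrow>
     W \<subseteq> carrier_vec d \<and> 0\<^sub>v d \<in> W \<and> (\<forall>v\<in>W. \<forall>w\<in>W. v + w \<in> W) \<and> (\<forall>c. \<forall>v\<in>W. c \<cdot>\<^sub>v v \<in> W)"
  using vec_vs[of d, where 'a=complex] vec_module[of d, where 'a=complex]
  by (auto simp: VectorSpace.subspace_def submodule_def module_vec_simps)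

lemma group_GL: "group (GL d)"
proof -
  interpret ring "ring_mat TYPE(complex) d ()" by (rule ring_mat)
  show ?thesis unfolding GL_def by (rule units_group)
qed

lemma GL_simps: "Group.monoid.mult (GL d) = (*)" "one (GL d) = 1\<^sub>m d"
  by (simp_all add: GL_def units_of_def ring_mat_simps)

lemma GL_carrierI:
  "A \<in> carrier_mat d d \<Longrightarrow> B \<in> carrier_mat d d \<Longrightarrow> A * B = 1\<^sub>m d \<Longrightarrow> B * A = 1\<^sub>m d \<Longrightarrow> A \<in> carrier (GL d)"
  by (auto simp: GL_def units_of_def Units_def ring_mat_simps)

lemma GL_carrierD: "A \<in> carrier (GL d) \<Longrightarrow> A \<in> carrier_mat d d"
  by (auto simp: GL_def units_of_def Units_def ring_mat_simps)

lemma (in group) representation_iff: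
  "representation G d \<rho> \<longleftrightarrow> (\<forall>g\<in>carrier G. \<rho> g \<in> carrier_mat d d) \<and> \<rho> \<one> = 1\<^sub>m d \<and>
     (\<forall>g\<in>carrier G. \<forall>h\<in>carrier G. \<rho> (g \<otimes> h) = \<rho> g * \<rho> h)"
proof
  assume "representation G d \<rho>"
  then have h: "\<rho> \<in> hom G (GL d)" by (simp add: representation_def)
  have "\<rho> \<one> = 1\<^sub>m d"
    using hom_one[OF h is_group group_GL] by (simp add: GL_simps)
  then show "(\<forall>g\<in>carrier G. \<rho> g \<in> carrier_mat d d) \<and> \<rho> \<one> = 1\<^sub>m d \<and>
     (\<forall>g\<in>carrier G. \<forall>h\<in>carrier G. \<rho> (g \<otimes> h) = \<rho> g * \<rho> h)"
    using h by (auto simp: hom_def GL_simps Pi_def dest: GL_carrierD)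
next
  assume *: "(\<forall>g\<in>carrier G. \<rho> g \<in> carrier_mat d d) \<and> \<rho> \<one> = 1\<^sub>m d \<and>
     (\<forall>g\<in>carrier G. \<forall>h\<in>carrier G. \<rho> (g \<otimes> h) = \<rho> g * \<rho> h)"
  have "\<rho> g \<in> carrier (GL d)" if g: "g \<in> carrier G" for g
  proof (rule GL_carrierI[of _ _ "\<rho> (inv g)"])
    show "\<rho> g * \<rho> (inv g) = 1\<^sub>m d" "\<rho> (inv g) * \<rho> g = 1\<^sub>m d"
      using * g by (metis inv_closed r_inv, metis inv_closed l_inv)
  qed (use * g in auto)
  then show "representation G d \<rho>"
    using * by (auto simp: representation_def hom_def GL_simps)
qed

lemma (in group) irreducible_representation_iff:
  "irreducible_representation G d \<rho> \<longleftrightarrow> representation G d \<rho> \<and> d > 0 \<and>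
     (\<forall>W. W \<subseteq> carrier_vec d \<and> 0\<^sub>v d \<in> W \<and> (\<forall>v\<in>W. \<forall>w\<in>W. v + w \<in> W) \<and>
          (\<forall>c. \<forall>v\<in>W. c \<cdot>\<^sub>v v \<in> W) \<and> (\<forall>g\<in>carrier G. \<forall>w\<in>W. \<rho> g *\<^sub>v w \<in> W)
        \<longrightarrow> W = {0\<^sub>v d} \<or> W = carrier_vec d)"
  unfolding irreducible_representation_def subspace_vec_iff by blast

lemma (in group) irreducible_representationD:
  assumes "irreducible_representation G d \<rho>" "W \<subseteq> carrier_vec d" "0\<^sub>v d \<in> W"
    and "\<And>v w. v \<in> W \<Longrightarrow> w \<in> W \<Longrightarrow> v + w \<in> W" "\<And>c v. v \<in> W \<Longrightarrow> c \<cdot>\<^sub>v v \<in> W"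
    and "\<And>g w. g \<in> carrier G \<Longrightarrow> w \<in> W \<Longrightarrow> \<rho> g *\<^sub>v w \<in> W"
  shows "W = {0\<^sub>v d} \<or> W = carrier_vec d"
  using assms unfolding irreducible_representation_iff by simp

lemma (in group) representation_pow:
  assumes "representation G d \<rho>" "g \<in> carrier G"
  shows "\<rho> (g [^] (k::nat)) = \<rho> g ^\<^sub>m k"
  using assms by (induction k) (auto simp: representation_iff)

lemma (in group) character_of_one:
  assumes "representation G d \<rho>"
  shows "character_of G \<rho> \<one> = of_nat d"
  using assms by (simp add: representation_iff character_of_def mat_trace_def)

lemma (in group) cod_nonneg:
  assumes "\<chi> \<in> Irr G"
  shows "cod G \<chi> \<ge> 0"
proof -
  obtain d \<rho> where "irreducible_representation G d \<rho>" "\<chi> = character_of G \<rho>"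
    using assms by (auto simp: Irr_def)
  then have "\<chi> \<one> = of_nat d" by (simp add: character_of_one irreducible_representation_def)
  then show ?thesis by (simp add: cod_def)
qed

text \<open>
  The orbit of a single nonzero vector spans an invariant subspace, hence everything.
\<close>
lemma (in group) irreducible_degree_le_order:
  assumes fin: "finite (carrier G)" and irr: "irreducible_representation G d \<rho>"
  shows "d \<le> card (carrier G)"
proof -
  interpret V: vec_space "TYPE(complex)" d .
  have rep: "\<And>g. g \<in> carrier G \<Longrightarrow> \<rho> g \<in> carrier_mat d d" "\<rho> \<one> = 1\<^sub>m d"
    "\<And>g h. g \<in> carrier G \<Longrightarrow> h \<in> carrier G \<Longrightarrow> \<rho> (g \<otimes> h) = \<rho> g * \<rho> h" and d: "d > 0"
    using irr by (auto simp: irreducible_representation_iff representation_iff)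
  define v :: "complex vec" where "v = unit_vec d 0"
  have v: "v \<in> carrier_vec d" by (simp add: v_def)
  define S where "S = (\<lambda>g. \<rho> g *\<^sub>v v) ` carrier G"
  have S: "S \<subseteq> carrier_vec d" using v by (auto simp: S_def intro!: mult_mat_vec_carrier[OF rep(1)])
  have finS: "finite S" using fin by (simp add: S_def)
  have SS: "S \<subseteq> V.span S" using S by (rule V.in_own_span)
  have sub: "VectorSpace.subspace class_ring (V.span S) V.V"
    using V.span_is_subspace S by blast
  then have span: "V.span S \<subseteq> carrier_vec d" "0\<^sub>v d \<in> V.span S"
      "\<And>u w. u \<in> V.span S \<Longrightarrow> w \<in> V.span S \<Longrightarrow> u + w \<in> V.span S"
      "\<And>c w. w \<in> V.span S \<Longrightarrow> c \<cdot>\<^sub>v w \<in> V.span S"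
    unfolding subspace_vec_iff by auto
  have inv: "\<rho> g *\<^sub>v w \<in> V.span S" if g: "g \<in> carrier G" and w: "w \<in> V.span S" for g w
  proof -
    \<comment> \<open>Invariance is checked on generators: the vectors that g maps into the span form a subspace.\<close>
    let ?N = "{u \<in> carrier_vec d. \<rho> g *\<^sub>v u \<in> V.span S}"
    have zero: "\<rho> g *\<^sub>v 0\<^sub>v d = 0\<^sub>v d" using rep(1)[OF g] by (intro eq_vecI) auto
    have "VectorSpace.subspace class_ring ?N V.V"
      unfolding subspace_vec_iff using rep(1)[OF g] span zero
      by (auto simp: mult_add_distrib_mat_vec mult_mat_vec[of _ d d])
    then have "submodule class_ring ?N V.V" by (simp add: VectorSpace.subspace_def)
    moreover have "S \<subseteq> ?N"
    proof
      fix u assume "u \<in> S"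
      then obtain h where h: "h \<in> carrier G" "u = \<rho> h *\<^sub>v v" by (auto simp: S_def)
      then have "\<rho> g *\<^sub>v u = \<rho> (g \<otimes> h) *\<^sub>v v"
        using g rep v by (simp add: assoc_mult_mat_vec[of _ d d _ d])
      also have "\<dots> \<in> S" using g h by (auto simp: S_def)
      finally show "u \<in> ?N" using SS S \<open>u \<in> S\<close> by auto
    qed
    ultimately have "V.span S \<subseteq> ?N" by (intro V.span_is_subset)
    then show ?thesis using w by blast
  qed
  have "v \<in> S" using rep(2) v by (auto simp: S_def intro!: image_eqI[of _ _ \<one>])
  then have "v \<in> V.span S" using SS by blast
  moreover have "v \<noteq> 0\<^sub>v d" using d by (auto simp: v_def dest: arg_cong[of _ _ "\<lambda>w. w $ 0"])
  ultimately have "V.span S \<noteq> {0\<^sub>v d}" by auto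
  then have "V.span S = carrier_vec d"
    using irreducible_representationD[OF irr span inv] by simp
  then have "V.dim \<le> card S" using V.gen_ge_dim finS S by auto
  also have "card S \<le> card (carrier G)" unfolding S_def by (rule card_image_le[OF fin])
  finally show ?thesis by (simp add: V.dim_is_n)
qed

lemma mat_trace_mult_comm:
  assumes "A \<in> carrier_mat d d" "B \<in> carrier_mat d d"
  shows "mat_trace (A * B) = mat_trace (B * A)"
proof -
  have "mat_trace (A * B) = (\<Sum>i<d. \<Sum>j<d. A $$ (i, j) * B $$ (j, i))"
    using assms by (auto simp: mat_trace_def scalar_prod_def lessThan_atLeast0 intro!: sum.cong)
  also have "\<dots> = (\<Sum>j<d. \<Sum>i<d. B $$ (j, i) * A $$ (i, j))"
    by (subst sum.swap) (simp add: mult.commute)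
  also have "\<dots> = mat_trace (B * A)"
    using assms by (auto simp: mat_trace_def scalar_prod_def lessThan_atLeast0 intro!: sum.cong)
  finally show ?thesis .
qed

text \<open>
  Over the complex numbers a matrix is similar to a triangular one, whose diagonal consists of
  eigenvalues; those of a matrix of finite order are roots of unity.
\<close>
lemma mat_trace_finite_order:
  assumes A: "A \<in> carrier_mat d d" and pow: "A ^\<^sub>m n = 1\<^sub>m d"
  shows "\<exists>es. set es \<subseteq> {z. z ^ n = 1} \<and> length es = d \<and> mat_trace A = sum_list es"
proof -
  obtain es where es: "char_poly A = (\<Prod>a\<leftarrow>es. [:- a, 1:])" "length es = d"
    using char_poly_factorized[OF A] by blast
  obtain B P Q where "schur_decomposition A es = (B, P, Q)"
    by (metis prod_cases3)
  from schur_decomposition[OF A es(1) this]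
  have wit: "similar_mat_wit A B P Q" and diag: "diag_mat B = es" by auto
  from similar_mat_witD2[OF A wit]
  have c: "B \<in> carrier_mat d d" "P \<in> carrier_mat d d" "Q \<in> carrier_mat d d"
    and QP: "Q * P = 1\<^sub>m d" and AB: "A = P * B * Q" by auto
  have "mat_trace A = mat_trace (Q * (P * B))"
    unfolding AB using c by (intro mat_trace_mult_comm[of _ d]) auto
  also have "Q * (P * B) = B" using c QP by (simp flip: assoc_mult_mat[of Q d d P d B d])
  also have "mat_trace B = sum_list es"
    using c diag by (auto simp: mat_trace_def diag_mat_def interv_sum_list_conv_sum_set_nat
        lessThan_atLeast0)
  finally have tr: "mat_trace A = sum_list es" .
  have "a ^ n = 1" if "a \<in> set es" for a
  proof -
    have "poly (char_poly A) a = 0"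
      using that by (auto simp: es(1) poly_prod_list prod_list_zero_iff)
    then obtain v where v: "eigenvector A v a"
      using eigenvalue_root_char_poly[OF A] by (auto simp: eigenvalue_def)
    then have v': "v \<in> carrier_vec d" "v \<noteq> 0\<^sub>v d" using A by (auto simp: eigenvector_def)
    have "v = a ^ n \<cdot>\<^sub>v v" using eigenvector_pow[OF A v, of n] pow v' by simp
    moreover obtain i where i: "i < d" "v $ i \<noteq> 0" using v' by (auto simp: vec_eq_iff)
    ultimately have "v $ i = a ^ n * v $ i" using v' by (metis carrier_vecD index_smult_vec(1))
    then show ?thesis using i by simp
  qed
  then show ?thesis using tr es(2) by blast
qed

lemma (in group) finite_order_le_card:
  assumes fin: "finite (carrier G)" and g: "g \<in> carrier G"
  shows "\<exists>k. 0 < k \<and> k \<le> card (carrier G) \<and> g [^] (k::nat) = \<one>"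
proof -
  let ?f = "\<lambda>k::nat. g [^] k" and ?n = "card (carrier G)"
  have "\<not> inj_on ?f {..?n}"
  proof
    assume "inj_on ?f {..?n}"
    then have "card {..?n} \<le> ?n" using g fin by (intro card_inj_on_le[of ?f]) auto
    then show False by simp
  qed
  then obtain i j where "i \<le> ?n" "j \<le> ?n" "i \<noteq> j" "?f i = ?f j" by (auto simp: inj_on_def)
  then obtain i j where ij: "i < j" "j \<le> ?n" "?f i = ?f j"
    by (metis linorder_neqE_nat)
  have "?f i \<otimes> ?f (j - i) = ?f j" using g ij(1) by (simp add: nat_pow_mult)
  then have "?f (j - i) = \<one>" using ij(3) g by (metis l_cancel_one nat_pow_closed)
  then show ?thesis using ij by (intro exI[of _ "j - i"]) auto
qed

text \<open>
  Degrees are bounded by the group order, and values are sums of at most that many roots of unity of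
  bounded order. So all irreducible characters lie in one finite set of functions; this is cheaper
  than the orthogonality relations.
\<close>
theorem (in group) finite_Irr:
  assumes fin: "finite (carrier G)"
  shows "finite (Irr G)"
proof -
  let ?n = "card (carrier G)"
  define R :: "complex set" where "R = (\<Union>k\<in>{1..?n}. {z. z ^ k = 1})"
  have finR: "finite R"
    unfolding R_def using finite_roots_unity[where 'a=complex] by auto
  define T :: "nat \<Rightarrow> complex set"
    where "T d = sum_list ` {es. set es \<subseteq> R \<and> length es = d}" for d
  have finT: "finite (T d)" for d
    unfolding T_def by (intro finite_imageI finite_lists_length_eq finR)
  have "Irr G \<subseteq> (\<Union>d\<le>?n. carrier G \<rightarrow>\<^sub>E T d)"
  proof
    fix \<chi> assume "\<chi> \<in> Irr G"
    then obtain d \<rho> where irr: "irreducible_representation G d \<rho>" and \<chi>: "\<chi> = character_of G \<rho>"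
      by (auto simp: Irr_def)
    have rep: "representation G d \<rho>" using irr by (simp add: irreducible_representation_def)
    have "mat_trace (\<rho> g) \<in> T d" if g: "g \<in> carrier G" for g
    proof -
      obtain k where k: "0 < k" "k \<le> ?n" "g [^] k = \<one>" using finite_order_le_card[OF fin g] by blast
      have "\<rho> g ^\<^sub>m k = 1\<^sub>m d"
        using representation_pow[OF rep g, of k] k(3) rep by (simp add: representation_iff)
      then obtain es where "set es \<subseteq> {z. z ^ k = 1}" "length es = d" "mat_trace (\<rho> g) = sum_list es"
        using mat_trace_finite_order[of "\<rho> g" d k] rep g unfolding representation_iff by blast
      moreover have "{z. z ^ k = 1} \<subseteq> R" using k unfolding R_def by (intro UN_upper) auto
      ultimately show ?thesis unfolding T_def by blast
    qed
    then have "\<chi> \<in> carrier G \<rightarrow>\<^sub>E T d" by (auto simp: \<chi> character_of_def)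
    then show "\<chi> \<in> (\<Union>d\<le>?n. carrier G \<rightarrow>\<^sub>E T d)"
      using irreducible_degree_le_order[OF fin irr] by blast
  qed
  then show ?thesis
    by (rule finite_subset) (use fin finT in \<open>auto intro!: finite_PiE\<close>)
qed

section \<open>Codegrees of cyclic groups\<close>

text \<open>
  Every element is a power of the generator, so an eigenvector of the generator spans an invariant
  line. By irreducibility the line is the whole space, and the character is given by the powers of
  the eigenvalue.
\<close>
lemma Irr_cyclic:
  assumes n: "n > 0" and "\<chi> \<in> Irr (integer_mod_group n)"
  shows "\<exists>z. z ^ n = 1 \<and> \<chi> = (\<lambda>k\<in>{0..<int n}. z ^ nat k)"
proof -
  let ?C = "integer_mod_group n"
  interpret C: group ?C by simp
  have car: "carrier ?C = {0..<int n}" using n by (simp add: carrier_integer_mod_group)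
  obtain d \<rho> where irr: "irreducible_representation ?C d \<rho>" and \<chi>: "\<chi> = character_of ?C \<rho>"
    using assms(2) by (auto simp: Irr_def)
  have rep: "representation ?C d \<rho>" and d: "d > 0"
    using irr by (auto simp: irreducible_representation_def)
  \<comment> \<open>Taking the residue makes the generator correct for n = 1 as well.\<close>
  let ?g = "1 mod int n"
  define A where "A = \<rho> ?g"
  have g: "?g \<in> carrier ?C" using n by (simp add: car)
  have A: "A \<in> carrier_mat d d" using rep g by (simp add: A_def C.representation_iff)
  have \<rho>: "\<rho> k = A ^\<^sub>m nat k" if "k \<in> carrier ?C" for k
  proof -
    have "?g [^]\<^bsub>?C\<^esub> nat k = k" using that by (simp add: car mod_mult_right_eq)
    then show ?thesis using C.representation_pow[OF rep g, of "nat k"] by (simp add: A_def)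
  qed
  have An: "A ^\<^sub>m n = 1\<^sub>m d"
  proof -
    have "?g [^]\<^bsub>?C\<^esub> n = \<one>\<^bsub>?C\<^esub>" by simp
    then have "A ^\<^sub>m n = \<rho> \<one>\<^bsub>?C\<^esub>" using C.representation_pow[OF rep g, of n] by (simp add: A_def)
    then show ?thesis using rep by (simp add: C.representation_iff)
  qed
  obtain z v where zv: "eigenvector A v z"
    using spectrum_non_empty[OF A] d by (auto simp: spectrum_def eigenvalue_def)
  then have v: "v \<in> carrier_vec d" "v \<noteq> 0\<^sub>v d" using A by (auto simp: eigenvector_def)
  have pow: "A ^\<^sub>m k *\<^sub>v v = z ^ k \<cdot>\<^sub>v v" for k by (rule eigenvector_pow[OF A zv])
  define W where "W = range (\<lambda>c. c \<cdot>\<^sub>v v)"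
  have "W = {0\<^sub>v d} \<or> W = carrier_vec d"
  proof -
    have "W \<subseteq> carrier_vec d" using v by (auto simp: W_def)
    moreover have "0\<^sub>v d \<in> W" using v by (auto simp: W_def intro!: image_eqI[of _ _ 0])
    moreover have "a + b \<in> W" if "a \<in> W" "b \<in> W" for a b
      using that by (auto simp: W_def simp flip: add_smult_distrib_vec)
    moreover have "c \<cdot>\<^sub>v a \<in> W" if "a \<in> W" for a c
      using that by (auto simp: W_def smult_smult_assoc)
    moreover have "\<rho> k *\<^sub>v w \<in> W" if k: "k \<in> carrier ?C" and w: "w \<in> W" for k w
    proof -
      obtain c where "w = c \<cdot>\<^sub>v v" using w unfolding W_def by blast
      moreover have "A ^\<^sub>m nat k \<in> carrier_mat d d" using A by simp
      ultimately have "\<rho> k *\<^sub>v w = (c * z ^ nat k) \<cdot>\<^sub>v v"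
        using \<rho>[OF k] v pow by (simp add: mult_mat_vec[of _ d d] smult_smult_assoc)
      then show ?thesis by (simp add: W_def)
    qed
    ultimately show ?thesis by (rule C.irreducible_representationD[OF irr])
  qed
  moreover have "v \<in> W" by (auto simp: W_def intro!: image_eqI[of _ _ 1])
  ultimately have W: "W = carrier_vec d" using v by auto
  have d1: "d = 1"
  proof (rule ccontr)
    assume "d \<noteq> 1"
    then have d2: "1 < d" using d by simp
    have "unit_vec d 0 \<in> W" "unit_vec d 1 \<in> W" by (simp_all add: W)
    then obtain a b where ab: "unit_vec d 0 = a \<cdot>\<^sub>v v" "unit_vec d 1 = b \<cdot>\<^sub>v v" by (auto simp: W_def)
    have "a * v $ 0 = 1" "a * v $ 1 = 0" "b * v $ 1 = 1"
      using arg_cong[OF ab(1), of "\<lambda>u. u $ 0"] arg_cong[OF ab(1), of "\<lambda>u. u $ 1"]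
        arg_cong[OF ab(2), of "\<lambda>u. u $ 1"] d2 v by auto
    then show False by auto
  qed
  have v0: "v $ 0 \<noteq> 0" using v d1 by (auto simp: vec_eq_iff)
  have tr: "mat_trace (A ^\<^sub>m k) = z ^ k" for k
  proof -
    have c: "A ^\<^sub>m k \<in> carrier_mat 1 1" using A d1 by simp
    then have "(A ^\<^sub>m k *\<^sub>v v) $ 0 = (A ^\<^sub>m k) $$ (0, 0) * v $ 0"
      using carrier_matD[OF c] carrier_vecD[OF v(1)] d1
      by (simp add: scalar_prod_def del: pow_mat_dim)
    moreover have "(A ^\<^sub>m k *\<^sub>v v) $ 0 = z ^ k * v $ 0" using pow v d1 by simp
    ultimately have "(A ^\<^sub>m k) $$ (0, 0) = z ^ k" using v0 by simp
    then show ?thesis using c by (auto simp: mat_trace_def)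
  qed
  have "z ^ n = 1" using tr[of n] d1 by (simp add: An mat_trace_def)
  moreover have "\<chi> = (\<lambda>k\<in>{0..<int n}. z ^ nat k)"
    using \<rho> tr by (auto simp: \<chi> character_of_def car fun_eq_iff)
  ultimately show ?thesis by blast
qed

text \<open>
  The j-th character is trivial on the multiples of n / gcd(j, n), of which there are gcd(j, n).
  An upper bound for the codegree only needs this part of the kernel.
\<close>
lemma cod_cyclic_le:
  assumes n: "n > 0"
  defines "\<chi> \<equiv> \<lambda>j. \<lambda>k\<in>{0..<int n}. cis (2 * pi * real j / real n) ^ nat k"
  shows "0 \<le> cod (integer_mod_group n) (\<chi> j)"
    and "cod (integer_mod_group n) (\<chi> j) \<le> real n / real (gcd j n)"
proof -
  let ?C = "integer_mod_group n" and ?z = "cis (2 * pi * real j / real n)"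
  interpret C: group ?C by simp
  have car: "carrier ?C = {0..<int n}" using n by (simp add: carrier_integer_mod_group)
  let ?K = "char_kernel ?C (\<chi> j)"
  have zn: "?z ^ n = 1" using n by (simp add: Complex.DeMoivre)
  have zmod: "?z ^ (k mod n) = ?z ^ k" for k
  proof -
    have "?z ^ k = ?z ^ (n * (k div n) + k mod n)" by simp
    also have "\<dots> = ?z ^ (k mod n)" by (simp only: power_add power_mult zn power_one mult_1)
    finally show ?thesis by simp
  qed
  have \<chi>0: "\<chi> j \<one>\<^bsub>?C\<^esub> = 1" using n by (simp add: \<chi>_def)
  have K: "?K = {k. 0 \<le> k \<and> k < int n \<and> ?z ^ nat k = 1}"
    unfolding char_kernel_def \<chi>0 car by (auto simp: \<chi>_def)
  have sub: "subgroup ?K ?C"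
  proof (rule C.subgroupI)
    show "?K \<subseteq> carrier ?C" by (auto simp: K car)
    show "?K \<noteq> {}" using n by (auto simp: K intro!: exI[of _ 0])
    have mult: "a \<otimes>\<^bsub>?C\<^esub> b \<in> ?K" if "a \<in> ?K" "b \<in> ?K" for a b
    proof -
      have "nat ((a + b) mod int n) = (nat a + nat b) mod n"
        using that by (simp add: K nat_mod_distrib nat_add_distrib)
      then show ?thesis using that n by (auto simp: K zmod power_add)
    qed
    then show "a \<otimes>\<^bsub>?C\<^esub> b \<in> ?K" if "a \<in> ?K" "b \<in> ?K" for a b using that .
    show "inv\<^bsub>?C\<^esub> a \<in> ?K" if "a \<in> ?K" for a
    proof -
      have a: "a \<in> carrier ?C" using that by (simp add: K car)
      have "nat ((a + (- a) mod int n) mod int n) = (nat a + nat ((- a) mod int n)) mod n"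
        using that n by (simp add: K nat_mod_distrib nat_add_distrib)
      moreover have "(a + (- a) mod int n) mod int n = 0" by (simp add: mod_add_right_eq)
      ultimately have "?z ^ (nat a + nat ((- a) mod int n)) = 1"
        by (metis zmod nat_0 power_0)
      then show ?thesis using that a n by (auto simp: K power_add)
    qed
  qed
  let ?g = "gcd j n"
  have g: "?g > 0" using n by simp
  obtain j' where j': "j = ?g * j'" by (meson dvdE gcd_dvd1)
  obtain m where m: "n = ?g * m" by (meson dvdE gcd_dvd2)
  have rj: "real j = real ?g * real j'" and rn: "real n = real ?g * real m"
    using j' m by (metis of_nat_mult)+
  have m0: "m > 0" using m n by (metis gr0I mult_0_right)
  have "(\<lambda>i. int (i * m)) ` {..<?g} \<subseteq> ?K"
  proof
    fix k assume "k \<in> (\<lambda>i. int (i * m)) ` {..<?g}"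
    then obtain i where i: "i < ?g" "k = int (i * m)" by auto
    have cancel: "(c * b) * (2 * pi * (a * e) / (a * b)) = 2 * pi * (c * e)"
      if "a \<noteq> 0" "b \<noteq> 0" for a b c e :: real
      using that by (simp add: field_simps)
    have "?z ^ (i * m) = cis (2 * pi * real (i * j'))"
    proof -
      have "real (i * m) * (2 * pi * real j / real n) = 2 * pi * real (i * j')"
        using n m0 cancel[of "real ?g" "real m" "real i" "real j'"] unfolding rn rj of_nat_mult by simp
      then show ?thesis by (simp add: Complex.DeMoivre)
    qed
    also have "\<dots> = 1" by (metis cis_multiple_2pi Ints_of_nat)
    finally have "?z ^ (i * m) = 1" .
    moreover have "i * m < n" using i(1) m0 by (subst m) simp
    ultimately show "k \<in> ?K" unfolding K i(2) by (auto simp del: of_nat_mult)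
  qed
  moreover have finK: "finite ?K" by (rule finite_subset[of _ "{0..<int n}"]) (auto simp: K)
  ultimately have "card ((\<lambda>i. int (i * m)) ` {..<?g}) \<le> card ?K" by (intro card_mono)
  also have "card ((\<lambda>i. int (i * m)) ` {..<?g}) = ?g"
    using m0 by (subst card_image) (auto simp: inj_on_def)
  finally have gK: "?g \<le> card ?K" .
  have "card (rcosets\<^bsub>?C\<^esub> ?K) * card ?K = n"
    using C.lagrange[OF sub] by (simp add: Coset.order_def car)
  then have "real (card (rcosets\<^bsub>?C\<^esub> ?K)) = real n / real (card ?K)"
    using gK g by (metis nonzero_eq_divide_eq of_nat_mult of_nat_0_less_iff order.strict_trans2 less_irrefl)
  then have cod: "cod ?C (\<chi> j) = real n / real (card ?K)" unfolding cod_def \<chi>0 by simp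
  then show "0 \<le> cod ?C (\<chi> j)" by simp
  show "cod ?C (\<chi> j) \<le> real n / real ?g"
    unfolding cod using gK g less_le_trans[OF g gK] by (intro divide_left_mono mult_pos_pos) simp_all
qed

lemma S_c_cyclic_le:
  assumes n: "n > 0"
  shows "S_c (integer_mod_group n) \<le> (\<Sum>j<n. real n / real (gcd j n))"
proof -
  let ?C = "integer_mod_group n"
  define \<chi> where "\<chi> j = (\<lambda>k\<in>{0..<int n}. cis (2 * pi * real j / real n) ^ nat k)" for j
  have "Irr ?C \<subseteq> \<chi> ` {..<n}"
  proof
    fix \<psi> assume "\<psi> \<in> Irr ?C"
    then obtain z where z: "z ^ n = 1" "\<psi> = (\<lambda>k\<in>{0..<int n}. z ^ nat k)" using Irr_cyclic n by blast
    then obtain j where "j < n" "z = cis (2 * pi * real j / real n)"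
      using bij_betw_roots_unity[OF n] unfolding bij_betw_def by blast
    then show "\<psi> \<in> \<chi> ` {..<n}" using z by (auto simp: \<chi>_def)
  qed
  then have "S_c ?C \<le> (\<Sum>\<psi>\<in>\<chi> ` {..<n}. cod ?C \<psi>)"
    unfolding S_c_def using cod_cyclic_le(1)[OF n] by (intro sum_mono2) (auto simp: \<chi>_def)
  also have "\<dots> \<le> (\<Sum>j<n. cod ?C (\<chi> j))"
    using cod_cyclic_le(1)[OF n] by (intro sum_image_le[unfolded o_def]) (auto simp: \<chi>_def)
  also have "\<dots> \<le> (\<Sum>j<n. real n / real (gcd j n))"
    using cod_cyclic_le(2)[OF n] by (intro sum_mono) (auto simp: \<chi>_def)
  finally show ?thesis .
qed

section \<open>Invariance under isomorphism\<close>

definition pull_char :: "('a, 'x) monoid_scheme \<Rightarrow> ('a \<Rightarrow> 'b) \<Rightarrow> ('b \<Rightarrow> complex) \<Rightarrow> 'a \<Rightarrow> complex" where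
  "pull_char G h \<chi> = (\<lambda>g\<in>carrier G. \<chi> (h g))"

text \<open>
  An isomorphism does not change the image of a representation, so the same subspaces are invariant.
\<close>
lemma Irr_pull_char:
  assumes G: "group G" and H: "group H" and h: "h \<in> iso G H" and \<chi>: "\<chi> \<in> Irr H"
  shows "pull_char G h \<chi> \<in> Irr G"
proof -
  interpret G: group G by fact
  interpret H: group H by fact
  have hom: "h \<in> hom G H" and img: "h ` carrier G = carrier H"
    using h by (auto simp: iso_def bij_betw_def)
  obtain d \<rho> where irr: "irreducible_representation H d \<rho>" and \<chi>: "\<chi> = character_of H \<rho>"
    using \<chi> by (auto simp: Irr_def)
  have hc: "h g \<in> carrier H" if "g \<in> carrier G" for g using hom that by (rule hom_in_carrier)
  have "irreducible_representation G d (\<rho> \<circ> h)"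
    unfolding G.irreducible_representation_iff
  proof (intro conjI allI impI)
    have "representation H d \<rho>" using irr by (simp add: irreducible_representation_def)
    then show "representation G d (\<rho> \<circ> h)"
      using hom hom_compose[OF hom] by (simp add: representation_def)
    show "d > 0" using irr by (simp add: irreducible_representation_def)
    fix W assume "W \<subseteq> carrier_vec d \<and> 0\<^sub>v d \<in> W \<and> (\<forall>v\<in>W. \<forall>w\<in>W. v + w \<in> W) \<and>
      (\<forall>c. \<forall>v\<in>W. c \<cdot>\<^sub>v v \<in> W) \<and> (\<forall>g\<in>carrier G. \<forall>w\<in>W. (\<rho> \<circ> h) g *\<^sub>v w \<in> W)"
    then show "W = {0\<^sub>v d} \<or> W = carrier_vec d"
      by (intro H.irreducible_representationD[OF irr]) (auto simp flip: img)
  qed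
  moreover have "pull_char G h \<chi> = character_of G (\<rho> \<circ> h)"
    using hc by (auto simp: pull_char_def \<chi> character_of_def)
  ultimately show ?thesis by (auto simp: Irr_def)
qed

lemma cod_pull_char:
  assumes G: "group G" and H: "group H" and h: "h \<in> iso G H"
  shows "cod G (pull_char G h \<chi>) = cod H \<chi>"
proof -
  interpret G: group G by fact
  interpret H: group H by fact
  have hom: "h \<in> hom G H" and bij: "bij_betw h (carrier G) (carrier H)"
    using h by (auto simp: iso_def)
  have img: "h ` carrier G = carrier H" and inj: "inj_on h (carrier G)"
    using bij by (auto simp: bij_betw_def)
  have one: "h \<one>\<^bsub>G\<^esub> = \<one>\<^bsub>H\<^esub>" by (rule hom_one[OF hom G H])
  let ?K = "char_kernel G (pull_char G h \<chi>)"
  have KG: "?K \<subseteq> carrier G" by (auto simp: char_kernel_def)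
  have K: "h ` ?K = char_kernel H \<chi>"
    using one by (auto simp: char_kernel_def pull_char_def simp flip: img)
  have coset: "h ` (?K #>\<^bsub>G\<^esub> g) = char_kernel H \<chi> #>\<^bsub>H\<^esub> h g" if g: "g \<in> carrier G" for g
  proof -
    have "h (k \<otimes>\<^bsub>G\<^esub> g) = h k \<otimes>\<^bsub>H\<^esub> h g" if "k \<in> ?K" for k
      using hom_mult[OF hom _ g] KG that by blast
    then show ?thesis unfolding r_coset_def K[symmetric] by (auto simp: image_UN)
  qed
  have "(\<lambda>X. h ` X) ` (rcosets\<^bsub>G\<^esub> ?K) = rcosets\<^bsub>H\<^esub> (char_kernel H \<chi>)"
    unfolding RCOSETS_def img[symmetric] using coset by auto
  moreover have "rcosets\<^bsub>G\<^esub> ?K \<subseteq> Pow (carrier G)"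
    using G.r_coset_subset_G[OF KG] by (auto simp: RCOSETS_def)
  then have "inj_on (\<lambda>X. h ` X) (rcosets\<^bsub>G\<^esub> ?K)"
    using inj_on_image_Pow[OF inj] by (rule inj_on_subset[rotated])
  ultimately have "card (rcosets\<^bsub>H\<^esub> (char_kernel H \<chi>)) = card (rcosets\<^bsub>G\<^esub> ?K)"
    by (metis card_image)
  then show ?thesis by (simp add: cod_def pull_char_def one)
qed

text \<open>
  Pulling back along the isomorphism and along its inverse are mutually inverse bijections between
  the irreducible characters; they are inverse as functions because characters are \<open>undefined\<close>
  outside the carrier.
\<close>
lemma S_c_iso:
  assumes G: "group G" and H: "group H" and h: "h \<in> iso G H"
  shows "S_c G = S_c H"
proof -
  define k where "k = inv_into (carrier G) h"
  have k: "k \<in> iso H G" unfolding k_def by (rule group.iso_set_sym[OF G h])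
  have bij: "bij_betw h (carrier G) (carrier H)" using h by (auto simp: iso_def)
  have kh: "k (h g) = g" if "g \<in> carrier G" for g
    unfolding k_def by (rule bij_betw_inv_into_left[OF bij that])
  have hk: "h (k x) = x" if "x \<in> carrier H" for x
    unfolding k_def by (rule bij_betw_inv_into_right[OF bij that])
  have closed: "k x \<in> carrier G" if "x \<in> carrier H" for x using k that by (auto simp: iso_def hom_def)
  have closed': "h x \<in> carrier H" if "x \<in> carrier G" for x using h that by (auto simp: iso_def hom_def)
  have ext: "\<chi> x = undefined" if "\<chi> \<in> Irr F" "x \<notin> carrier F" for \<chi> x and F :: "('z, 'w) monoid_scheme"
    using that by (auto simp: Irr_def character_of_def)
  show ?thesis unfolding S_c_def
  proof (rule sum.reindex_bij_witness[of _ "pull_char G h" "pull_char H k"])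
    fix \<chi> assume \<chi>: "\<chi> \<in> Irr G"
    show "pull_char G h (pull_char H k \<chi>) = \<chi>"
      using kh closed' ext[OF \<chi>] by (auto simp: pull_char_def fun_eq_iff)
    show "pull_char H k \<chi> \<in> Irr H" by (rule Irr_pull_char[OF H G k \<chi>])
    show "cod H (pull_char H k \<chi>) = cod G \<chi>" by (rule cod_pull_char[OF H G k])
  next
    fix \<chi> assume \<chi>: "\<chi> \<in> Irr H"
    show "pull_char H k (pull_char G h \<chi>) = \<chi>"
      using hk closed ext[OF \<chi>] by (auto simp: pull_char_def fun_eq_iff)
    show "pull_char G h \<chi> \<in> Irr G" by (rule Irr_pull_char[OF G H h \<chi>])
  qed
qed

lemma finite_group_copy_on_nat:
  fixes G :: "('a, 'x) monoid_scheme"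
  assumes "group G" "finite (carrier G)"
  obtains H :: "nat monoid" and h where "group H" "h \<in> iso G H"
proof -
  interpret G: group G by fact
  obtain f :: "'a \<Rightarrow> nat" where f: "inj_on f (carrier G)"
    using finite_imp_inj_to_nat_seg[OF assms(2)] by blast
  define g where "g = inv_into (carrier G) f"
  have g: "g (f x) = x" if "x \<in> carrier G" for x unfolding g_def using f that by simp
  define H :: "nat monoid" where "H = \<lparr>carrier = f ` carrier G,
    monoid.mult = (\<lambda>x y. f (g x \<otimes>\<^bsub>G\<^esub> g y)), one = f \<one>\<^bsub>G\<^esub>\<rparr>"
  have "group H"
  proof (rule groupI)
    show "\<exists>y\<in>carrier H. y \<otimes>\<^bsub>H\<^esub> x = \<one>\<^bsub>H\<^esub>" if x: "x \<in> carrier H" for x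
    proof -
      obtain a where "a \<in> carrier G" "x = f a" using x by (auto simp: H_def)
      then show ?thesis by (intro bexI[of _ "f (inv\<^bsub>G\<^esub> a)"]) (auto simp: H_def g)
    qed
  qed (auto simp: H_def g G.m_assoc)
  moreover have "f \<in> iso G H"
    using f g by (auto simp: iso_def hom_def H_def bij_betw_def)
  ultimately show ?thesis by (rule that)
qed

section \<open>Characters of a semidirect product induced from the abelian normal subgroup\<close>

definition linear_char :: "('a, 'b) monoid_scheme \<Rightarrow> ('a \<Rightarrow> complex) \<Rightarrow> bool" where
  "linear_char A \<phi> \<longleftrightarrow> \<phi> \<one>\<^bsub>A\<^esub> = 1 \<and> (\<forall>a\<in>carrier A. \<forall>b\<in>carrier A. \<phi> (a \<otimes>\<^bsub>A\<^esub> b) = \<phi> a * \<phi> b)"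

lemma linear_char_one: "linear_char A \<phi> \<Longrightarrow> \<phi> \<one>\<^bsub>A\<^esub> = 1"
  and linear_char_mult: "linear_char A \<phi> \<Longrightarrow> a \<in> carrier A \<Longrightarrow> b \<in> carrier A \<Longrightarrow>
    \<phi> (a \<otimes>\<^bsub>A\<^esub> b) = \<phi> a * \<phi> b"
  by (auto simp: linear_char_def)

lemma (in group) linear_char_norm:
  assumes fin: "finite (carrier G)" and \<phi>: "linear_char G \<phi>" and a: "a \<in> carrier G"
  shows "norm (\<phi> a) = 1"
proof -
  obtain k where k: "0 < k" "a [^] (k::nat) = \<one>" using finite_order_le_card[OF fin a] by blast
  have "\<phi> (a [^] j) = \<phi> a ^ j" for j :: nat
    by (induction j) (use \<phi> a in \<open>auto simp: linear_char_def\<close>)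
  then have "\<phi> a ^ k = 1" using k \<phi> by (metis linear_char_one)
  then have "norm (\<phi> a) ^ k = 1" by (metis norm_one norm_power)
  then show ?thesis using k(1) power_eq_imp_eq_base[of "norm (\<phi> a)" k 1] by simp
qed

text \<open>
  If the characters differ at b, translation by b multiplies the sum by a scalar other than 1.
\<close>
lemma (in comm_group) linear_char_orthogonality:
  assumes \<phi>: "linear_char G \<phi>" and \<mu>: "linear_char G \<mu>"
  shows "(\<Sum>a\<in>carrier G. \<phi> a * \<mu> (inv a))
    = (if \<forall>a\<in>carrier G. \<phi> a = \<mu> a then of_nat (card (carrier G)) else 0)"
proof -
  have \<mu>inv: "\<mu> a * \<mu> (inv a) = 1" if "a \<in> carrier G" for a
    using linear_char_mult[OF \<mu> that, of "inv a"] that by (simp add: linear_char_one[OF \<mu>])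
  show ?thesis
  proof (cases "\<forall>a\<in>carrier G. \<phi> a = \<mu> a")
    case True
    then have "(\<Sum>a\<in>carrier G. \<phi> a * \<mu> (inv a)) = (\<Sum>a\<in>carrier G. 1)"
      using \<mu>inv by (intro sum.cong) auto
    then show ?thesis using True by simp
  next
    case False
    then obtain b where b: "b \<in> carrier G" "\<phi> b \<noteq> \<mu> b" by auto
    let ?S = "\<Sum>a\<in>carrier G. \<phi> a * \<mu> (inv a)"
    have "?S = (\<Sum>a\<in>carrier G. \<phi> (b \<otimes> a) * \<mu> (inv (b \<otimes> a)))"
      by (rule sum.reindex_bij_betw[symmetric])
        (use b in \<open>auto intro!: bij_betwI[where g="\<lambda>a. inv b \<otimes> a"] simp: m_assoc[symmetric]\<close>)
    also have "\<dots> = (\<Sum>a\<in>carrier G. \<phi> b * \<mu> (inv b) * (\<phi> a * \<mu> (inv a)))"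
      using b(1) by (intro sum.cong refl)
        (simp add: inv_mult linear_char_mult[OF \<phi>] linear_char_mult[OF \<mu>] mult_ac)
    also have "\<dots> = \<phi> b * \<mu> (inv b) * ?S" by (simp add: sum_distrib_left)
    finally have "?S * \<mu> b = \<phi> b * (\<mu> b * \<mu> (inv b)) * ?S" by (simp add: mult_ac)
    then have "?S * \<mu> b = ?S * \<phi> b" using \<mu>inv[OF b(1)] by (simp add: mult_ac)
    then have "?S = 0" using b(2) by simp
    then show ?thesis using False by auto
  qed
qed

text \<open>
  The equality case of the triangle inequality, read off from real parts.
\<close>
lemma sum_unit_complex_eq_card:
  fixes f :: "'x \<Rightarrow> complex"
  assumes fin: "finite S" and norm: "\<And>s. s \<in> S \<Longrightarrow> norm (f s) = 1"
    and sum: "(\<Sum>s\<in>S. f s) = of_nat (card S)" and s: "s \<in> S"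
  shows "f s = 1"
proof -
  have le: "Re (f s) \<le> 1" if "s \<in> S" for s using complex_Re_le_cmod[of "f s"] norm[OF that] by simp
  have "(\<Sum>s\<in>S. 1 - Re (f s)) = 0"
    using arg_cong[OF sum, of Re] by (simp add: sum_subtractf)
  then have "\<forall>s\<in>S. 1 - Re (f s) = 0"
    using fin le by (subst (asm) sum_nonneg_eq_0_iff) auto
  then have re: "Re (f s) = 1" using s by auto
  then have "Im (f s) = 0" using norm[OF s] by (simp add: cmod_def)
  with re show ?thesis by (simp add: complex_eq_iff)
qed

locale semidirect =
  A: comm_group A + C: group C
  for A :: "('a, 'x) monoid_scheme" and C :: "('c, 'y) monoid_scheme" +
  fixes act :: "'c \<Rightarrow> 'a \<Rightarrow> 'a"
  assumes finA: "finite (carrier A)" and finC: "finite (carrier C)"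
    and act_closed [simp]: "\<And>c a. c \<in> carrier C \<Longrightarrow> a \<in> carrier A \<Longrightarrow> act c a \<in> carrier A"
    and act_mult: "\<And>c a b. c \<in> carrier C \<Longrightarrow> a \<in> carrier A \<Longrightarrow> b \<in> carrier A \<Longrightarrow>
      act c (a \<otimes>\<^bsub>A\<^esub> b) = act c a \<otimes>\<^bsub>A\<^esub> act c b"
    and act_one [simp]: "\<And>a. a \<in> carrier A \<Longrightarrow> act \<one>\<^bsub>C\<^esub> a = a"
    and act_comp: "\<And>c d a. c \<in> carrier C \<Longrightarrow> d \<in> carrier C \<Longrightarrow> a \<in> carrier A \<Longrightarrow>
      act (c \<otimes>\<^bsub>C\<^esub> d) a = act c (act d a)"
begin

lemma act_unit [simp]: "c \<in> carrier C \<Longrightarrow> act c \<one>\<^bsub>A\<^esub> = \<one>\<^bsub>A\<^esub>"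
  using act_mult[of c "\<one>\<^bsub>A\<^esub>" "\<one>\<^bsub>A\<^esub>"] by (simp add: A.l_cancel_one')

lemma act_inv_cancel:
  "c \<in> carrier C \<Longrightarrow> a \<in> carrier A \<Longrightarrow> act (inv\<^bsub>C\<^esub> c) (act c a) = a"
  by (simp flip: act_comp)

definition semidirect_product :: "('a \<times> 'c) monoid" where
  "semidirect_product = \<lparr>carrier = carrier A \<times> carrier C,
    monoid.mult = (\<lambda>(a, c) (b, d). (a \<otimes>\<^bsub>A\<^esub> act c b, c \<otimes>\<^bsub>C\<^esub> d)), one = (\<one>\<^bsub>A\<^esub>, \<one>\<^bsub>C\<^esub>)\<rparr>"

lemma semidirect_product_simps [simp]:
  "carrier semidirect_product = carrier A \<times> carrier C" "\<one>\<^bsub>semidirect_product\<^esub> = (\<one>\<^bsub>A\<^esub>, \<one>\<^bsub>C\<^esub>)"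
  "(a, c) \<otimes>\<^bsub>semidirect_product\<^esub> (b, d) = (a \<otimes>\<^bsub>A\<^esub> act c b, c \<otimes>\<^bsub>C\<^esub> d)"
  by (simp_all add: semidirect_product_def)

lemma group_semidirect_product: "group semidirect_product"
proof (rule groupI)
  show "\<exists>y\<in>carrier semidirect_product. y \<otimes>\<^bsub>semidirect_product\<^esub> x = \<one>\<^bsub>semidirect_product\<^esub>" if "x \<in> carrier semidirect_product" for x
  proof -
    have "x \<in> carrier A \<times> carrier C" using that by simp
    then obtain a c where x: "x = (a, c)" "a \<in> carrier A" "c \<in> carrier C" by (elim SigmaE)
    then show ?thesis
      by (intro bexI[of _ "(act (inv\<^bsub>C\<^esub> c) (inv\<^bsub>A\<^esub> a), inv\<^bsub>C\<^esub> c)"]) (simp_all flip: act_mult)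
  qed
qed (auto simp: act_mult act_comp A.m_assoc C.m_assoc)

sublocale SD: group semidirect_product by (rule group_semidirect_product)

lemma finite_semidirect_product: "finite (carrier semidirect_product)" using finA finC by simp

lemma linear_char_act:
  "linear_char A \<phi> \<Longrightarrow> c \<in> carrier C \<Longrightarrow> linear_char A (\<lambda>a. \<phi> (act c a))"
  by (simp add: linear_char_def act_mult)

text \<open>
  Matrix of the representation induced from the linear character \<open>\<phi>\<close> of A, in the basis indexed by
  the elements of C through the enumeration e: the basis vector at d is sent by (a, c) to a multiple
  of the basis vector at c d.
\<close>
definition induced :: "(nat \<Rightarrow> 'c) \<Rightarrow> ('a \<Rightarrow> complex) \<Rightarrow> 'a \<times> 'c \<Rightarrow> complex mat" where
  "induced e \<phi> = (\<lambda>(a, c). mat (card (carrier C)) (card (carrier C))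
     (\<lambda>(i, j). if c \<otimes>\<^bsub>C\<^esub> e j = e i then \<phi> (act (inv\<^bsub>C\<^esub> (e i)) a) else 0))"

context
  fixes e :: "nat \<Rightarrow> 'c" and \<phi> :: "'a \<Rightarrow> complex"
  assumes e: "bij_betw e {..<card (carrier C)} (carrier C)"
    and \<phi>: "linear_char A \<phi>"
begin

private lemma e_closed [simp]: "i < card (carrier C) \<Longrightarrow> e i \<in> carrier C"
  using e by (auto simp: bij_betw_def)

private lemma e_inj [simp]:
  "i < card (carrier C) \<Longrightarrow> j < card (carrier C) \<Longrightarrow> e i = e j \<longleftrightarrow> i = j"
  using e by (auto simp: bij_betw_def inj_on_def)

private lemma e_surj: "c \<in> carrier C \<Longrightarrow> \<exists>i<card (carrier C). e i = c"
  using e by (metis bij_betw_imp_surj_on imageE lessThan_iff)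

lemma representation_induced: "representation semidirect_product (card (carrier C)) (induced e \<phi>)"
  unfolding SD.representation_iff
proof (intro conjI ballI)
  let ?n = "card (carrier C)"
  show "induced e \<phi> g \<in> carrier_mat ?n ?n" for g by (cases g) (simp add: induced_def)
  show "induced e \<phi> \<one>\<^bsub>semidirect_product\<^esub> = 1\<^sub>m ?n"
    by (rule eq_matI) (auto simp: induced_def linear_char_one[OF \<phi>])
  fix g h assume "g \<in> carrier semidirect_product" "h \<in> carrier semidirect_product"
  then obtain a c b d where g: "g = (a, c)" "a \<in> carrier A" "c \<in> carrier C"
    and h: "h = (b, d)" "b \<in> carrier A" "d \<in> carrier C" by auto
  show "induced e \<phi> (g \<otimes>\<^bsub>semidirect_product\<^esub> h) = induced e \<phi> g * induced e \<phi> h"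
  proof (rule eq_matI)
    fix i j assume "i < dim_row (induced e \<phi> g * induced e \<phi> h)" "j < dim_col (induced e \<phi> g * induced e \<phi> h)"
    then have i: "i < ?n" and j: "j < ?n" by (simp_all add: induced_def g h)
    obtain k where k: "k < ?n" "e k = d \<otimes>\<^bsub>C\<^esub> e j" using e_surj h(3) j by (metis C.m_closed e_closed)
    have "(induced e \<phi> g * induced e \<phi> h) $$ (i, j)
      = (\<Sum>l<?n. (if c \<otimes>\<^bsub>C\<^esub> e l = e i then \<phi> (act (inv\<^bsub>C\<^esub> (e i)) a) else 0) *
                 (if d \<otimes>\<^bsub>C\<^esub> e j = e l then \<phi> (act (inv\<^bsub>C\<^esub> (e l)) b) else 0))"
      using i j by (simp add: induced_def g h scalar_prod_def lessThan_atLeast0)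
    also have "\<dots> = (\<Sum>l<?n. if l = k then (if c \<otimes>\<^bsub>C\<^esub> e k = e i then \<phi> (act (inv\<^bsub>C\<^esub> (e i)) a) else 0)
          * \<phi> (act (inv\<^bsub>C\<^esub> (e k)) b) else 0)"
      by (intro sum.cong refl) (use k in \<open>auto simp flip: k(2)\<close>)
    also have "\<dots> = (if c \<otimes>\<^bsub>C\<^esub> e k = e i then \<phi> (act (inv\<^bsub>C\<^esub> (e i)) a) * \<phi> (act (inv\<^bsub>C\<^esub> (e k)) b) else 0)"
      using k(1) by simp
    also have "\<dots> = induced e \<phi> (g \<otimes>\<^bsub>semidirect_product\<^esub> h) $$ (i, j)"
    proof (cases "c \<otimes>\<^bsub>C\<^esub> e k = e i")
      case True
      have "inv\<^bsub>C\<^esub> (e k) = inv\<^bsub>C\<^esub> (e i) \<otimes>\<^bsub>C\<^esub> c"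
        using True g(3) k(1) by (metis C.inv_closed C.inv_mult_group C.inv_solve_right C.m_closed e_closed)
      then have "act (inv\<^bsub>C\<^esub> (e k)) b = act (inv\<^bsub>C\<^esub> (e i)) (act c b)"
        using g h i by (simp add: act_comp)
      then show ?thesis
        using True g h i j k by (simp add: induced_def C.m_assoc act_mult linear_char_mult[OF \<phi>])
    next
      case False
      then show ?thesis using g h i j k by (simp add: induced_def C.m_assoc)
    qed
    finally show "induced e \<phi> (g \<otimes>\<^bsub>semidirect_product\<^esub> h) $$ (i, j) = (induced e \<phi> g * induced e \<phi> h) $$ (i, j)" ..
  qed (simp_all add: induced_def g h)
qed

text \<open>
  An element outside A permutes the basis lines without fixed points, so its diagonal is zero.
\<close>
lemma character_of_induced:
  assumes a: "a \<in> carrier A" and c: "c \<in> carrier C"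
  shows "character_of semidirect_product (induced e \<phi>) (a, c)
    = (if c = \<one>\<^bsub>C\<^esub> then \<Sum>d\<in>carrier C. \<phi> (act (inv\<^bsub>C\<^esub> d) a) else 0)"
proof -
  let ?n = "card (carrier C)"
  have fix_iff: "c \<otimes>\<^bsub>C\<^esub> e i = e i \<longleftrightarrow> c = \<one>\<^bsub>C\<^esub>" if "i < ?n" for i
    using that c by simp
  have "character_of semidirect_product (induced e \<phi>) (a, c)
      = (\<Sum>i<?n. if c = \<one>\<^bsub>C\<^esub> then \<phi> (act (inv\<^bsub>C\<^esub> (e i)) a) else 0)"
    using a c fix_iff by (simp add: character_of_def mat_trace_def induced_def cong: sum.cong_simp)
  also have "\<dots> = (if c = \<one>\<^bsub>C\<^esub> then \<Sum>i<?n. \<phi> (act (inv\<^bsub>C\<^esub> (e i)) a) else 0)" by simp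
  also have "(\<Sum>i<?n. \<phi> (act (inv\<^bsub>C\<^esub> (e i)) a)) = (\<Sum>d\<in>carrier C. \<phi> (act (inv\<^bsub>C\<^esub> d) a))"
    by (rule sum.reindex_bij_betw[OF e])
  finally show ?thesis .
qed

text \<open>
  A acts diagonally, and by assumption any two of the diagonal characters are separated by an element
  of A. An invariant subspace therefore contains a basis vector: a nonzero vector of minimal
  support in it cannot have two nonzero coordinates, as one of them could be cancelled. As C permutes
  the basis transitively up to scalars, the subspace then contains the whole basis.
\<close>
lemma irreducible_induced:
  assumes free: "\<And>c. c \<in> carrier C \<Longrightarrow> c \<noteq> \<one>\<^bsub>C\<^esub> \<Longrightarrow> \<exists>a\<in>carrier A. \<phi> (act c a) \<noteq> \<phi> a"
  shows "irreducible_representation semidirect_product (card (carrier C)) (induced e \<phi>)"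
  unfolding SD.irreducible_representation_iff
proof (intro conjI allI impI)
  let ?n = "card (carrier C)"
  show "representation semidirect_product ?n (induced e \<phi>)" by (rule representation_induced)
  show "?n > 0" using finC by (simp add: card_gt_0_iff C.carrier_not_empty)
  fix W assume W: "W \<subseteq> carrier_vec ?n \<and> 0\<^sub>v ?n \<in> W \<and> (\<forall>v\<in>W. \<forall>w\<in>W. v + w \<in> W) \<and>
      (\<forall>c. \<forall>v\<in>W. c \<cdot>\<^sub>v v \<in> W) \<and> (\<forall>g\<in>carrier semidirect_product. \<forall>w\<in>W. induced e \<phi> g *\<^sub>v w \<in> W)"
  then have Wc: "W \<subseteq> carrier_vec ?n" and W0: "0\<^sub>v ?n \<in> W"
    and Wadd: "\<And>v w. v \<in> W \<Longrightarrow> w \<in> W \<Longrightarrow> v + w \<in> W" and Wsm: "\<And>c v. v \<in> W \<Longrightarrow> c \<cdot>\<^sub>v v \<in> W"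
    and Winv: "\<And>a c w. a \<in> carrier A \<Longrightarrow> c \<in> carrier C \<Longrightarrow> w \<in> W \<Longrightarrow> induced e \<phi> (a, c) *\<^sub>v w \<in> W"
    by auto
  have entry: "(induced e \<phi> (a, c) *\<^sub>v w) $ i
      = (\<Sum>j<?n. (if c \<otimes>\<^bsub>C\<^esub> e j = e i then \<phi> (act (inv\<^bsub>C\<^esub> (e i)) a) else 0) * w $ j)"
    if "w \<in> carrier_vec ?n" "i < ?n" for a c w i
    using that by (simp add: induced_def scalar_prod_def lessThan_atLeast0)
  have diag: "(induced e \<phi> (a, \<one>\<^bsub>C\<^esub>) *\<^sub>v w) $ i = \<phi> (act (inv\<^bsub>C\<^esub> (e i)) a) * w $ i"
    if "w \<in> carrier_vec ?n" "i < ?n" for a w i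
  proof -
    have "(induced e \<phi> (a, \<one>\<^bsub>C\<^esub>) *\<^sub>v w) $ i
        = (\<Sum>j<?n. if j = i then \<phi> (act (inv\<^bsub>C\<^esub> (e i)) a) * w $ i else 0)"
      unfolding entry[OF that] by (intro sum.cong refl) (use that in auto)
    then show ?thesis using that by simp
  qed
  have separate: "\<exists>a\<in>carrier A. \<phi> (act (inv\<^bsub>C\<^esub> (e i)) a) \<noteq> \<phi> (act (inv\<^bsub>C\<^esub> (e j)) a)"
    if "i < ?n" "j < ?n" "i \<noteq> j" for i j
  proof -
    have "inv\<^bsub>C\<^esub> (e i) \<otimes>\<^bsub>C\<^esub> e j \<noteq> \<one>\<^bsub>C\<^esub>"
      using that by (metis C.inv_closed C.inv_equality C.inv_inv e_closed e_inj)
    moreover have "inv\<^bsub>C\<^esub> (e i) \<otimes>\<^bsub>C\<^esub> e j \<in> carrier C" using that by simp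
    ultimately obtain b where b: "b \<in> carrier A" "\<phi> (act (inv\<^bsub>C\<^esub> (e i) \<otimes>\<^bsub>C\<^esub> e j) b) \<noteq> \<phi> b"
      using free[of "inv\<^bsub>C\<^esub> (e i) \<otimes>\<^bsub>C\<^esub> e j"] by auto
    then show ?thesis
      using that by (intro bexI[of _ "act (e j) b"]) (simp_all add: act_comp act_inv_cancel)
  qed
  define supp where "supp w = {i. i < ?n \<and> w $ i \<noteq> (0::complex)}" for w
  have fsupp: "finite (supp w)" for w by (simp add: supp_def)
  have supp0: "w = 0\<^sub>v ?n" if "w \<in> carrier_vec ?n" "supp w = {}" for w
    using that by (intro eq_vecI) (auto simp: supp_def)
  show "W = {0\<^sub>v ?n} \<or> W = carrier_vec ?n"
  proof (cases "W = {0\<^sub>v ?n}")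
    case False
    then obtain w0 where "w0 \<in> W" "w0 \<noteq> 0\<^sub>v ?n" using W0 by blast
    then obtain w where w: "w \<in> W" "w \<noteq> 0\<^sub>v ?n"
      and minw: "\<And>u. u \<in> W \<Longrightarrow> u \<noteq> 0\<^sub>v ?n \<Longrightarrow> card (supp w) \<le> card (supp u)"
      using ex_has_least_nat[of "\<lambda>u. u \<in> W \<and> u \<noteq> 0\<^sub>v ?n" w0 "\<lambda>u. card (supp u)"] by blast
    have wc: "w \<in> carrier_vec ?n" using w Wc by blast
    obtain i where i: "i \<in> supp w" using supp0 wc w(2) by blast
    then have i': "i < ?n" "w $ i \<noteq> 0" by (auto simp: supp_def)
    have zero: "w $ j = 0" if j: "j < ?n" "j \<noteq> i" for j
    proof (rule ccontr)
      assume wj: "w $ j \<noteq> 0"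
      obtain a where a: "a \<in> carrier A" "\<phi> (act (inv\<^bsub>C\<^esub> (e i)) a) \<noteq> \<phi> (act (inv\<^bsub>C\<^esub> (e j)) a)"
        using separate[of i j] i' j by auto
      \<comment> \<open>Subtracting a multiple of w cancels coordinate j and keeps coordinate i, as a separates them.\<close>
      define u where "u = induced e \<phi> (a, \<one>\<^bsub>C\<^esub>) *\<^sub>v w + (- \<phi> (act (inv\<^bsub>C\<^esub> (e j)) a)) \<cdot>\<^sub>v w"
      have uW: "u \<in> W" unfolding u_def using a w by (intro Wadd Wsm Winv) auto
      have u: "u $ k = (\<phi> (act (inv\<^bsub>C\<^esub> (e k)) a) - \<phi> (act (inv\<^bsub>C\<^esub> (e j)) a)) * w $ k" if "k < ?n" for k
        unfolding u_def using that wc diag[OF wc that, of a] by (simp add: algebra_simps)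
      have "supp u \<subseteq> supp w - {j}" by (auto simp: supp_def u)
      moreover have "j \<in> supp w" using wj j by (simp add: supp_def)
      ultimately have "supp u \<subset> supp w" by blast
      then have "card (supp u) < card (supp w)" by (rule psubset_card_mono[OF fsupp])
      moreover have "u $ i \<noteq> 0" using u[OF i'(1)] a i' by simp
      then have "u \<noteq> 0\<^sub>v ?n" using i' by auto
      ultimately show False using minw[OF uW] by simp
    qed
    have unit_i: "unit_vec ?n i \<in> W"
    proof -
      have "unit_vec ?n i = (1 / w $ i) \<cdot>\<^sub>v w"
        using i' zero wc by (intro eq_vecI) auto
      then show ?thesis using Wsm[OF w(1)] by simp
    qed
    have unit: "unit_vec ?n j \<in> W" if j: "j < ?n" for j
    proof -
      let ?c = "e j \<otimes>\<^bsub>C\<^esub> inv\<^bsub>C\<^esub> (e i)"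
      have c: "?c \<in> carrier C" using j i' by simp
      have ci: "?c \<otimes>\<^bsub>C\<^esub> e i = e j" using j i' by (simp add: C.m_assoc)
      have "induced e \<phi> (\<one>\<^bsub>A\<^esub>, ?c) *\<^sub>v unit_vec ?n i = unit_vec ?n j"
      proof (rule eq_vecI)
        fix k assume "k < dim_vec (unit_vec ?n j :: complex vec)"
        then have k: "k < ?n" by simp
        have "(induced e \<phi> (\<one>\<^bsub>A\<^esub>, ?c) *\<^sub>v unit_vec ?n i) $ k
            = (\<Sum>l<?n. if l = i then (if ?c \<otimes>\<^bsub>C\<^esub> e i = e k then 1 else 0) else 0)"
          unfolding entry[OF unit_vec_carrier k]
          by (intro sum.cong refl) (use k i' in \<open>auto simp: linear_char_one[OF \<phi>]\<close>)
        also have "\<dots> = unit_vec ?n j $ k" using i' j k by (auto simp: ci)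
        finally show "(induced e \<phi> (\<one>\<^bsub>A\<^esub>, ?c) *\<^sub>v unit_vec ?n i) $ k = unit_vec ?n j $ k" .
      qed (simp add: induced_def)
      then show ?thesis using Winv[OF _ c unit_i, of "\<one>\<^bsub>A\<^esub>"] by simp
    qed
    have "v \<in> W" if v: "v \<in> carrier_vec ?n" for v
    proof -
      have "m \<le> ?n \<Longrightarrow> vec ?n (\<lambda>i. if i < m then v $ i else 0) \<in> W" for m
      proof (induction m)
        case 0
        have "vec ?n (\<lambda>i. if i < 0 then v $ i else 0) = 0\<^sub>v ?n" by (intro eq_vecI) auto
        then show ?case using W0 by simp
      next
        case (Suc m)
        have "vec ?n (\<lambda>i. if i < Suc m then v $ i else 0)
            = vec ?n (\<lambda>i. if i < m then v $ i else 0) + v $ m \<cdot>\<^sub>v unit_vec ?n m"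
          using Suc.prems by (intro eq_vecI) (auto simp: less_Suc_eq)
        then show ?case using Suc Wadd Wsm unit by simp
      qed
      from this[of ?n] have "vec ?n (\<lambda>i. if i < ?n then v $ i else 0) \<in> W" by simp
      moreover have "vec ?n (\<lambda>i. if i < ?n then v $ i else 0) = v" using v by (intro eq_vecI) auto
      ultimately show ?thesis by simp
    qed
    then show ?thesis using Wc by blast
  qed simp
qed

text \<open>
  An element of the kernel lies in A because the character vanishes elsewhere, and there the
  character is a sum of unit complex numbers that can only reach its degree if all of them are 1.
\<close>
lemma cod_induced:
  assumes faithful: "\<And>a. a \<in> carrier A \<Longrightarrow> (\<And>c. c \<in> carrier C \<Longrightarrow> \<phi> (act c a) = 1) \<Longrightarrow> a = \<one>\<^bsub>A\<^esub>"
  shows "cod semidirect_product (character_of semidirect_product (induced e \<phi>)) = real (card (carrier A))"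
proof -
  let ?\<chi> = "character_of semidirect_product (induced e \<phi>)" and ?n = "card (carrier C)"
  have one: "?\<chi> \<one>\<^bsub>semidirect_product\<^esub> = of_nat ?n" by (rule SD.character_of_one[OF representation_induced])
  have n: "?n > 0" using finC by (simp add: card_gt_0_iff C.carrier_not_empty)
  have "char_kernel semidirect_product ?\<chi> = {\<one>\<^bsub>semidirect_product\<^esub>}"
  proof
    show "{\<one>\<^bsub>semidirect_product\<^esub>} \<subseteq> char_kernel semidirect_product ?\<chi>" unfolding char_kernel_def by (auto simp del: semidirect_product_simps)
    show "char_kernel semidirect_product ?\<chi> \<subseteq> {\<one>\<^bsub>semidirect_product\<^esub>}"
    proof
      fix g assume "g \<in> char_kernel semidirect_product ?\<chi>"
      then obtain a c where g: "g = (a, c)" "a \<in> carrier A" "c \<in> carrier C" "?\<chi> (a, c) = of_nat ?n"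
        unfolding char_kernel_def one by auto
      then have c: "c = \<one>\<^bsub>C\<^esub>" and sum: "(\<Sum>d\<in>carrier C. \<phi> (act (inv\<^bsub>C\<^esub> d) a)) = of_nat ?n"
        using n character_of_induced[OF g(2,3)] by (auto split: if_splits)
      have "\<phi> (act (inv\<^bsub>C\<^esub> d) a) = 1" if "d \<in> carrier C" for d
        by (rule sum_unit_complex_eq_card[OF finC _ sum that])
          (use g A.linear_char_norm[OF finA \<phi>] in simp)
      then have "\<phi> (act d a) = 1" if "d \<in> carrier C" for d
        using that by (metis C.inv_closed C.inv_inv)
      then have "a = \<one>\<^bsub>A\<^esub>" using faithful g(2) by blast
      then show "g \<in> {\<one>\<^bsub>semidirect_product\<^esub>}" using g c by simp
    qed
  qed
  then have "cod semidirect_product ?\<chi> = real (Coset.order semidirect_product) / real ?n"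
    unfolding cod_def one using SD.card_rcosets_triv[OF finite_semidirect_product] by simp
  then show ?thesis using n by (simp add: Coset.order_def card_cartesian_product)
qed

end

text \<open>
  The multiplicity of \<open>\<mu>\<close> in the restriction of the induced character to A, up to the factor |A|, is
  zero for \<open>\<phi>\<close> if no conjugate of \<open>\<phi>\<close> equals \<open>\<mu>\<close>, and positive for \<open>\<mu>\<close> itself.
\<close>
lemma character_of_induced_eq_imp_conjugate:
  assumes e: "bij_betw e {..<card (carrier C)} (carrier C)"
    and \<phi>: "linear_char A \<phi>" and \<mu>: "linear_char A \<mu>"
    and eq: "character_of semidirect_product (induced e \<phi>) = character_of semidirect_product (induced e \<mu>)"
  shows "\<exists>c\<in>carrier C. \<forall>a\<in>carrier A. \<mu> a = \<phi> (act c a)"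
proof (rule ccontr)
  assume neg: "\<not> ?thesis"
  \<comment> \<open>Up to the factor |A|, this is the inner product of the restricted character with the character \<open>\<mu>\<close>.\<close>
  define F where "F \<nu> = (\<Sum>a\<in>carrier A. character_of semidirect_product (induced e \<nu>) (a, \<one>\<^bsub>C\<^esub>) * \<mu> (inv\<^bsub>A\<^esub> a))" for \<nu>
  have F: "F \<nu> = (\<Sum>c\<in>carrier C. if \<forall>a\<in>carrier A. \<nu> (act (inv\<^bsub>C\<^esub> c) a) = \<mu> a
      then of_nat (card (carrier A)) else 0)" if \<nu>: "linear_char A \<nu>" for \<nu>
  proof -
    have "F \<nu> = (\<Sum>a\<in>carrier A. \<Sum>c\<in>carrier C. \<nu> (act (inv\<^bsub>C\<^esub> c) a) * \<mu> (inv\<^bsub>A\<^esub> a))"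
      unfolding F_def by (intro sum.cong refl) (simp add: character_of_induced[OF e \<nu>] sum_distrib_right)
    also have "\<dots> = (\<Sum>c\<in>carrier C. \<Sum>a\<in>carrier A. \<nu> (act (inv\<^bsub>C\<^esub> c) a) * \<mu> (inv\<^bsub>A\<^esub> a))"
      by (rule sum.swap)
    also have "\<dots> = (\<Sum>c\<in>carrier C. if \<forall>a\<in>carrier A. \<nu> (act (inv\<^bsub>C\<^esub> c) a) = \<mu> a
      then of_nat (card (carrier A)) else 0)"
      by (intro sum.cong refl A.linear_char_orthogonality linear_char_act \<nu> \<mu>) auto
    finally show ?thesis .
  qed
  have "F \<phi> = 0" unfolding F[OF \<phi>]
  proof (intro sum.neutral ballI)
    fix c assume "c \<in> carrier C"
    then have "inv\<^bsub>C\<^esub> c \<in> carrier C" by simp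
    then show "(if \<forall>a\<in>carrier A. \<phi> (act (inv\<^bsub>C\<^esub> c) a) = \<mu> a then of_nat (card (carrier A)) else 0) = (0::complex)"
      using neg by metis
  qed
  moreover define N where "N c = (if \<forall>a\<in>carrier A. \<mu> (act (inv\<^bsub>C\<^esub> c) a) = \<mu> a
      then card (carrier A) else 0)" for c
  have "F \<mu> = of_nat (\<Sum>c\<in>carrier C. N c)"
    unfolding F[OF \<mu>] of_nat_sum N_def by (intro sum.cong refl) auto
  moreover have "F \<phi> = F \<mu>" by (simp add: F_def eq)
  ultimately have "of_nat (\<Sum>c\<in>carrier C. N c) = (0 :: complex)" by simp
  then have "(\<Sum>c\<in>carrier C. N c) = 0" by (simp only: of_nat_eq_0_iff)
  then have "N \<one>\<^bsub>C\<^esub> = 0" using finC by simp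
  then show False using finA A.one_closed unfolding N_def by (auto split: if_splits)
qed

text \<open>
  Each index yields an irreducible faithful character of codegree |A|, and the indices that yield
  the same character are conjugate under C, so there are at most |C| of them.
\<close>
theorem S_c_ge:
  fixes I :: "'i set" and L :: "'i \<Rightarrow> 'a \<Rightarrow> complex"
  assumes finI: "finite I" and lin: "\<And>i. i \<in> I \<Longrightarrow> linear_char A (L i)"
    and inj: "\<And>i j. i \<in> I \<Longrightarrow> j \<in> I \<Longrightarrow> (\<And>a. a \<in> carrier A \<Longrightarrow> L i a = L j a) \<Longrightarrow> i = j"
    and free: "\<And>i c. i \<in> I \<Longrightarrow> c \<in> carrier C \<Longrightarrow> c \<noteq> \<one>\<^bsub>C\<^esub> \<Longrightarrow> \<exists>a\<in>carrier A. L i (act c a) \<noteq> L i a"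
    and faithful: "\<And>i a. i \<in> I \<Longrightarrow> a \<in> carrier A \<Longrightarrow> (\<And>c. c \<in> carrier C \<Longrightarrow> L i (act c a) = 1) \<Longrightarrow> a = \<one>\<^bsub>A\<^esub>"
  shows "S_c semidirect_product \<ge> real (card (carrier A)) * real (card I) / real (card (carrier C))"
proof -
  let ?n = "card (carrier C)"
  obtain e where e: "bij_betw e {..<?n} (carrier C)"
    using ex_bij_betw_nat_finite[OF finC] by (metis lessThan_atLeast0)
  define \<chi> where "\<chi> i = character_of semidirect_product (induced e (L i))" for i
  have n: "?n > 0" using finC by (simp add: card_gt_0_iff C.carrier_not_empty)
  have "\<chi> i \<in> Irr semidirect_product" if "i \<in> I" for i
  proof -
    have "irreducible_representation semidirect_product ?n (induced e (L i))"
      by (rule irreducible_induced[OF e lin[OF that] free[OF that]])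
    then show ?thesis unfolding Irr_def \<chi>_def by blast
  qed
  then have sub: "\<chi> ` I \<subseteq> Irr semidirect_product" by blast
  have cod: "cod semidirect_product (\<chi> i) = real (card (carrier A))" if "i \<in> I" for i
    unfolding \<chi>_def by (rule cod_induced[OF e lin[OF that] faithful[OF that]])
  have fibre: "card {j \<in> I. \<chi> j = x} \<le> ?n" if x: "x \<in> \<chi> ` I" for x
  proof -
    obtain i where i: "i \<in> I" "x = \<chi> i" using x by blast
    have "\<forall>j\<in>{j \<in> I. \<chi> j = x}. \<exists>c\<in>carrier C. \<forall>a\<in>carrier A. L j a = L i (act c a)"
      using character_of_induced_eq_imp_conjugate[OF e lin[OF i(1)] lin] i(2)
      unfolding \<chi>_def by simp
    from bchoice[OF this[unfolded Bex_def]] obtain c where c: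
      "\<And>j. j \<in> I \<Longrightarrow> \<chi> j = x \<Longrightarrow> c j \<in> carrier C"
      "\<And>j a. j \<in> I \<Longrightarrow> \<chi> j = x \<Longrightarrow> a \<in> carrier A \<Longrightarrow> L j a = L i (act (c j) a)"
      by blast
    show ?thesis
    proof (rule card_inj_on_le[OF _ _ finC])
      show "inj_on c {j \<in> I. \<chi> j = x}"
      proof (rule inj_onI)
        fix j k assume "j \<in> {j \<in> I. \<chi> j = x}" "k \<in> {j \<in> I. \<chi> j = x}" "c j = c k"
        then show "j = k" by (intro inj) (simp_all add: c(2))
      qed
      show "c ` {j \<in> I. \<chi> j = x} \<subseteq> carrier C" using c(1) by auto
    qed
  qed
  have "card I = (\<Sum>x\<in>\<chi> ` I. card {j \<in> I. \<chi> j = x})"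
    using sum.image_gen[OF finI, of "\<lambda>_. 1::nat" \<chi>] by simp
  also have "\<dots> \<le> card (\<chi> ` I) * ?n"
    using sum_bounded_above[of "\<chi> ` I" "\<lambda>x. card {j \<in> I. \<chi> j = x}" ?n] fibre by simp
  finally have cI: "real (card I) \<le> real (card (\<chi> ` I)) * real ?n"
    by (metis of_nat_le_iff of_nat_mult)
  have "real (card (carrier A)) * real (card I) / real ?n \<le> real (card (carrier A)) * real (card (\<chi> ` I))"
    using mult_left_mono[OF cI, of "real (card (carrier A))"] n by (simp add: field_simps)
  also have "\<dots> = (\<Sum>x\<in>\<chi> ` I. real (card (carrier A)))" by simp
  also have "\<dots> = (\<Sum>x\<in>\<chi> ` I. cod semidirect_product x)"
    by (rule sum.cong[OF refl]) (use cod in auto)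
  also have "\<dots> \<le> S_c semidirect_product"
    unfolding S_c_def
    by (rule sum_mono2[OF SD.finite_Irr[OF finite_semidirect_product] sub]) (use SD.cod_nonneg in blast)
  finally show ?thesis .
qed

end

section \<open>Signed permutations acting on the plane modulo m\<close>

text \<open>
  The k-th power of the primitive m-th root of unity, with an integer exponent because the
  exponents below are differences.
\<close>
definition unity_root :: "nat \<Rightarrow> int \<Rightarrow> complex" where
  "unity_root m k = cis (2 * pi * real_of_int k / real m)"

lemma unity_root_add: "unity_root m (k + l) = unity_root m k * unity_root m l"
  by (simp add: unity_root_def cis_mult add_divide_distrib ring_distribs)

lemma unity_root_0: "unity_root m 0 = 1" by (simp add: unity_root_def)

lemma unity_root_eq_1_iff:
  assumes "m > 0"
  shows "unity_root m k = 1 \<longleftrightarrow> int m dvd k"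
proof
  assume "unity_root m k = 1"
  then have "cos (2 * pi * real_of_int k / real m) = 1"
    unfolding unity_root_def by (metis cis.sel(1) one_complex.sel(1))
  then obtain l :: int where "2 * pi * real_of_int k / real m = real_of_int l * 2 * pi"
    by (auto simp: cos_one_2pi_int)
  then have "real_of_int k = real_of_int (l * int m)"
    using assms by (simp add: field_simps)
  then have "k = l * int m" by (simp only: of_int_eq_iff)
  then show "int m dvd k" by simp
next
  assume "int m dvd k"
  then obtain l where "k = int m * l" by (elim dvdE)
  then have "2 * pi * real_of_int k / real m = 2 * pi * real_of_int l" using assms by simp
  then show "unity_root m k = 1" by (simp add: unity_root_def cis_multiple_2pi)
qed

lemma unity_root_eq_iff:
  assumes "m > 0"
  shows "unity_root m k = unity_root m l \<longleftrightarrow> int m dvd k - l"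
proof -
  have "unity_root m k = unity_root m (k - l) * unity_root m l" by (simp flip: unity_root_add)
  moreover have "unity_root m l \<noteq> 0" by (simp add: unity_root_def)
  ultimately have "unity_root m k = unity_root m l \<longleftrightarrow> unity_root m (k - l) = 1" by auto
  then show ?thesis using unity_root_eq_1_iff[OF assms] by simp
qed

definition plane :: "nat \<Rightarrow> (int \<times> int) monoid" where
  "plane m = \<lparr>carrier = {0..<int m} \<times> {0..<int m},
    monoid.mult = (\<lambda>(a, b) (c, d). ((a + c) mod int m, (b + d) mod int m)), one = (0, 0)\<rparr>"

lemma lin_comb_mod:
  fixes x y u v k :: int
  shows "(x * (u mod k) + y * (v mod k)) mod k = (x * u + y * v) mod k"
  by (metis mod_add_eq mod_mult_right_eq)

type_synonym mat2 = "int \<times> int \<times> int \<times> int"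

text \<open>
  A tuple (p, q, r, s) is the matrix with rows (p, q) and (r, s).
\<close>
definition signed_perms :: "mat2 monoid" where
  "signed_perms = \<lparr>carrier = {(1,0,0,1), (-1,0,0,1), (1,0,0,-1), (-1,0,0,-1),
      (0,1,1,0), (0,-1,1,0), (0,1,-1,0), (0,-1,-1,0)},
    monoid.mult = (\<lambda>(p, q, r, s) (p', q', r', s'). (p * p' + q * r', p * q' + q * s', r * p' + s * r', r * q' + s * s')),
    one = (1,0,0,1)\<rparr>"

definition mat2_act :: "nat \<Rightarrow> mat2 \<Rightarrow> int \<times> int \<Rightarrow> int \<times> int" where
  "mat2_act m = (\<lambda>(p, q, r, s) (x, y). ((p * x + q * y) mod int m, (r * x + s * y) mod int m))"

lemma comm_group_plane:
  assumes "m > 0"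
  shows "comm_group (plane m)"
proof (rule comm_groupI)
  fix x y z
  assume x: "x \<in> carrier (plane m)" and "y \<in> carrier (plane m)" and "z \<in> carrier (plane m)"
  show "x \<otimes>\<^bsub>plane m\<^esub> y \<in> carrier (plane m)"
    using assms by (simp add: plane_def split: prod.splits)
  show "x \<otimes>\<^bsub>plane m\<^esub> y \<otimes>\<^bsub>plane m\<^esub> z = x \<otimes>\<^bsub>plane m\<^esub> (y \<otimes>\<^bsub>plane m\<^esub> z)"
    by (simp add: plane_def mod_add_left_eq mod_add_right_eq add.assoc split: prod.splits)
  show "x \<otimes>\<^bsub>plane m\<^esub> y = y \<otimes>\<^bsub>plane m\<^esub> x"
    by (simp add: plane_def add.commute split: prod.splits)
  show "\<one>\<^bsub>plane m\<^esub> \<otimes>\<^bsub>plane m\<^esub> x = x"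
    using x by (auto simp: plane_def)
  show "\<exists>y\<in>carrier (plane m). y \<otimes>\<^bsub>plane m\<^esub> x = \<one>\<^bsub>plane m\<^esub>"
  proof (rule bexI)
    show "((- fst x) mod int m, (- snd x) mod int m) \<otimes>\<^bsub>plane m\<^esub> x = \<one>\<^bsub>plane m\<^esub>"
      by (simp add: plane_def mod_add_left_eq split: prod.splits)
    show "((- fst x) mod int m, (- snd x) mod int m) \<in> carrier (plane m)"
      using assms by (simp add: plane_def)
  qed
qed (use assms in \<open>simp add: plane_def\<close>)

lemma group_signed_perms: "group signed_perms"
proof (rule groupI)
  have "\<forall>x\<in>carrier signed_perms. \<forall>y\<in>carrier signed_perms. x \<otimes>\<^bsub>signed_perms\<^esub> y \<in> carrier signed_perms"
    by (simp add: signed_perms_def)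
  then show "x \<otimes>\<^bsub>signed_perms\<^esub> y \<in> carrier signed_perms"
    if "x \<in> carrier signed_perms" "y \<in> carrier signed_perms" for x y
    using that by blast
  have "\<forall>x\<in>carrier signed_perms. \<exists>y\<in>carrier signed_perms. y \<otimes>\<^bsub>signed_perms\<^esub> x = \<one>\<^bsub>signed_perms\<^esub>"
    by (simp add: signed_perms_def)
  then show "\<exists>y\<in>carrier signed_perms. y \<otimes>\<^bsub>signed_perms\<^esub> x = \<one>\<^bsub>signed_perms\<^esub>"
    if "x \<in> carrier signed_perms" for x
    using that by blast
  show "x \<otimes>\<^bsub>signed_perms\<^esub> y \<otimes>\<^bsub>signed_perms\<^esub> z = x \<otimes>\<^bsub>signed_perms\<^esub> (y \<otimes>\<^bsub>signed_perms\<^esub> z)" for x y z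
    by (cases x; cases y; cases z) (simp add: signed_perms_def algebra_simps)
  show "\<one>\<^bsub>signed_perms\<^esub> \<in> carrier signed_perms" by (simp add: signed_perms_def)
  show "\<one>\<^bsub>signed_perms\<^esub> \<otimes>\<^bsub>signed_perms\<^esub> x = x" for x
    by (cases x) (simp add: signed_perms_def)
qed

lemma card_signed_perms: "card (carrier signed_perms) = 8"
  by (simp add: signed_perms_def)

lemma card_plane: "card (carrier (plane m)) = m * m"
  by (simp add: plane_def card_cartesian_product)

lemma semidirect_plane:
  assumes "m > 0"
  shows "semidirect (plane m) signed_perms (mat2_act m)"
proof -
  interpret A: comm_group "plane m" using comm_group_plane[OF assms] .
  interpret C: group signed_perms by (rule group_signed_perms)
  show ?thesis
  proof unfold_locales
    show "finite (carrier (plane m))" "finite (carrier signed_perms)"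
      by (simp_all add: plane_def signed_perms_def)
    show "mat2_act m c a \<in> carrier (plane m)" for c a
      using assms by (simp add: plane_def mat2_act_def split: prod.splits)
    show "mat2_act m c (a \<otimes>\<^bsub>plane m\<^esub> b) = mat2_act m c a \<otimes>\<^bsub>plane m\<^esub> mat2_act m c b" for c a b
      by (cases c; cases a; cases b)
        (simp add: plane_def mat2_act_def lin_comb_mod mod_add_eq algebra_simps)
    show "mat2_act m \<one>\<^bsub>signed_perms\<^esub> a = a" if "a \<in> carrier (plane m)" for a
      using that by (auto simp: plane_def mat2_act_def signed_perms_def)
    show "mat2_act m (c \<otimes>\<^bsub>signed_perms\<^esub> d) a = mat2_act m c (mat2_act m d a)" for c d a
      by (cases c; cases d; cases a) (simp add: signed_perms_def mat2_act_def lin_comb_mod algebra_simps)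
  qed
qed

definition plane_char :: "nat \<Rightarrow> nat \<times> nat \<Rightarrow> int \<times> int \<Rightarrow> complex" where
  "plane_char m = (\<lambda>(x, y) (a, b). unity_root m (int x * a + int y * b))"

lemma unity_root_lin_comb_mod:
  assumes "m > 0"
  shows "unity_root m (x * (u mod int m) + y * (v mod int m)) = unity_root m (x * u + y * v)"
  unfolding unity_root_eq_iff[OF assms] mod_eq_dvd_iff[symmetric] by (rule lin_comb_mod)

lemma linear_char_plane_char:
  assumes "m > 0"
  shows "linear_char (plane m) (plane_char m u)"
proof -
  have "unity_root m (x * (a + c) + y * (b + d)) = unity_root m (x * a + y * b) * unity_root m (x * c + y * d)"
    for x y a b c d :: int
    unfolding unity_root_add[symmetric] by (simp add: algebra_simps)
  then show ?thesis
    by (cases u)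
      (auto simp: linear_char_def plane_def plane_char_def unity_root_0 unity_root_lin_comb_mod[OF assms])
qed

text \<open>
  Acting on the argument of the character amounts to the transposed action on its vector.
\<close>
lemma plane_char_act:
  assumes "m > 0"
  shows "plane_char m (x, y) (mat2_act m (p, q, r, s) (a, b))
    = unity_root m ((int x * p + int y * r) * a + (int x * q + int y * s) * b)"
  by (simp add: plane_char_def mat2_act_def unity_root_lin_comb_mod[OF assms]) (simp add: algebra_simps)

text \<open>
  The divisibility condition makes the induced character faithful. The four conditions after it
  exclude the vectors that some signed permutation other than the identity fixes modulo the product
  of P; for odd primes there are no others.
\<close>
definition generic_vectors :: "nat set \<Rightarrow> (nat \<times> nat) set" where
  "generic_vectors P = {(x, y). x < \<Prod>P \<and> y < \<Prod>P \<and> (\<forall>p\<in>P. \<not> (p dvd x \<and> p dvd y)) \<and>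
     x \<noteq> 0 \<and> y \<noteq> 0 \<and> x \<noteq> y \<and> x + y \<noteq> \<Prod>P}"

text \<open>
  Each of the four linear conditions excludes at most m pairs, and 4 m is at most m^2/4
  once m is at least 16.
\<close>
lemma card_generic_vectors:
  fixes P :: "nat set"
  assumes "finite P" "\<And>p. p \<in> P \<Longrightarrow> prime p \<and> odd p" "\<Prod>P \<ge> 16"
  shows "real (\<Prod>P) ^ 2 / 4 \<le> real (card (generic_vectors P))"
proof -
  let ?m = "\<Prod>P"
  let ?U = "{(x, y). x < ?m \<and> y < ?m \<and> (\<forall>p\<in>P. \<not> (p dvd x \<and> p dvd y))}"
  \<comment> \<open>The two axes, the diagonal and the antidiagonal.\<close>
  let ?B = "(\<lambda>x. (0, x)) ` {..<?m} \<union> (\<lambda>x. (x, 0)) ` {..<?m} \<union> (\<lambda>x. (x, x)) ` {..<?m}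
    \<union> (\<lambda>x. (x, ?m - x)) ` {..<?m}"
  have fin: "finite (generic_vectors P)"
    by (rule finite_subset[of _ "{..<?m} \<times> {..<?m}"]) (auto simp: generic_vectors_def)
  have "?U \<subseteq> generic_vectors P \<union> ?B"
    by (auto simp: generic_vectors_def image_iff)
  then have "card ?U \<le> card (generic_vectors P \<union> ?B)"
    using fin by (intro card_mono) auto
  also have "\<dots> \<le> card (generic_vectors P) + card ?B" by (rule card_Un_le)
  also have "card ?B \<le> card {..<?m} + card {..<?m} + card {..<?m} + card {..<?m}"
    by (intro order_trans[OF card_Un_le] add_mono card_image_le) auto
  finally have "card ?U \<le> card (generic_vectors P) + 4 * ?m" by simp
  from of_nat_mono[OF this, where 'a=real]
  have "real (card ?U) \<le> real (card (generic_vectors P)) + 4 * real ?m" by simp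
  moreover have "real ?m ^ 2 / 2 \<le> real (card ?U)"
    by (rule card_pairs_without_common_prime[OF assms(1,2)])
  moreover have "4 * real ?m \<le> real ?m ^ 2 / 4"
  proof -
    have "16 * real ?m \<le> real ?m * real ?m" using assms(3) by (intro mult_right_mono) (auto simp del: of_nat_prod)
    then show ?thesis by (simp add: power2_eq_square)
  qed
  ultimately show ?thesis by simp
qed

text \<open>
  If a lies in the kernel of all conjugates of the character of (x, y), combining the sign changes
  and the swap shows that m divides the products of x and y with each coordinate of a; as no p
  divides both x and y, the coordinates vanish.
\<close>
lemma S_c_semidirect_plane_ge:
  fixes P :: "nat set"
  assumes fin: "finite P" and P: "\<And>p. p \<in> P \<Longrightarrow> prime p \<and> odd p" and m16: "\<Prod>P \<ge> 16"
  defines "m \<equiv> \<Prod>P"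
  shows "S_c (semidirect.semidirect_product (plane m) signed_perms (mat2_act m)) \<ge> real m ^ 4 / 32"
proof -
  have m0: "m > 0" and m1: "m > 1" using m16 by (auto simp: m_def)
  interpret semidirect "plane m" signed_perms "mat2_act m" by (rule semidirect_plane[OF m0])
  have dvd_small: "k = 0" if "int m dvd k" "\<bar>k\<bar> < int m" for k
    using that by (metis dvd_imp_le_int not_le abs_of_nat)
  have odd: "odd m" unfolding m_def using fin P by (simp add: even_prod_iff)
  have dvd_half: "int m dvd k" if "int m dvd 2 * k" for k
  proof -
    have "coprime (int m) 2" using odd by (simp add: coprime_right_2_iff_odd)
    then show ?thesis using that by (simp add: coprime_dvd_mult_right_iff)
  qed
  have dvd_cancel: "t = 0"
    if u: "(x, y) \<in> generic_vectors P" and t: "0 \<le> t" "t < int m"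
      and d: "int m dvd int x * t" "int m dvd int y * t" for x y t
  proof -
    have "m dvd nat t" unfolding m_def
    proof (rule prod_primes_dvd[OF fin])
      fix p assume p: "p \<in> P"
      then show "prime p" using P by simp
      have pm: "p dvd m" unfolding m_def by (rule dvd_prodI[OF fin p])
      have "m dvd x * nat t" "m dvd y * nat t"
        using d t(1) by (metis int_dvd_int_iff int_nat_eq of_nat_mult)+
      then have "p dvd x * nat t" "p dvd y * nat t" using pm dvd_trans by blast+
      moreover have "\<not> (p dvd x \<and> p dvd y)" using u p by (auto simp: generic_vectors_def)
      ultimately show "p dvd nat t" using P[OF p] by (auto simp: prime_dvd_mult_iff)
    qed
    then show ?thesis using t by (metis dvd_imp_le linorder_not_less nat_0_iff nat_less_iff neq0_conv
        order_antisym_conv)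
  qed
  have basis: "(1, 0) \<in> carrier (plane m)" "(0, 1) \<in> carrier (plane m)"
    using m1 by (auto simp: plane_def)
  have "real (card (carrier (plane m))) * real (card (generic_vectors P)) / real (card (carrier signed_perms))
      \<le> S_c semidirect_product"
  proof (rule S_c_ge[where L="plane_char m"])
    show "finite (generic_vectors P)"
      by (rule finite_subset[of _ "{..<m} \<times> {..<m}"]) (auto simp: generic_vectors_def m_def)
    show "linear_char (plane m) (plane_char m u)" for u by (rule linear_char_plane_char[OF m0])
  next
    fix u v assume uv: "u \<in> generic_vectors P" "v \<in> generic_vectors P"
      and eq: "\<And>a. a \<in> carrier (plane m) \<Longrightarrow> plane_char m u a = plane_char m v a"
    obtain x y x' y' where u: "u = (x, y)" and v: "v = (x', y')" by (cases u; cases v) auto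
    have lt: "x < m" "y < m" "x' < m" "y' < m" using uv by (auto simp: generic_vectors_def u v m_def)
    have "int m dvd int x - int x'" "int m dvd int y - int y'"
      using eq[OF basis(1)] eq[OF basis(2)] by (simp_all add: u v plane_char_def unity_root_eq_iff[OF m0])
    then have "int x - int x' = 0" "int y - int y' = 0"
      by (intro dvd_small; use lt in linarith)+
    then show "u = v" by (simp add: u v)
  next
    fix u c assume u: "u \<in> generic_vectors P" and c: "c \<in> carrier signed_perms" "c \<noteq> \<one>\<^bsub>signed_perms\<^esub>"
    obtain x y where xy: "u = (x, y)" by (cases u)
    obtain p q r s where pqrs: "c = (p, q, r, s)" by (cases c)
    have g: "0 < x" "x < m" "0 < y" "y < m" "x \<noteq> y" "x + y \<noteq> m"
      using u by (auto simp: generic_vectors_def xy m_def)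
    show "\<exists>a\<in>carrier (plane m). plane_char m u (mat2_act m c a) \<noteq> plane_char m u a"
    proof (rule ccontr)
      assume "\<not> ?thesis"
      then have "plane_char m u (mat2_act m c (1, 0)) = plane_char m u (1, 0)"
        "plane_char m u (mat2_act m c (0, 1)) = plane_char m u (0, 1)" using basis by blast+
      then have d: "int m dvd int x * p + int y * r - int x" "int m dvd int x * q + int y * s - int y"
        unfolding xy pqrs plane_char_act[OF m0] by (simp_all add: plane_char_def unity_root_eq_iff[OF m0])
      have no_x: "\<not> int m dvd 2 * int x" and no_y: "\<not> int m dvd 2 * int y"
        using g dvd_half[of "int x"] dvd_half[of "int y"] dvd_small[of "int x"] dvd_small[of "int y"]
        by auto
      have no_diff: "\<not> int m dvd int y - int x"
      proof
        assume "int m dvd int y - int x"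
        then have "int y - int x = 0" by (rule dvd_small) (use g in linarith)
        then show False using g by simp
      qed
      have no_sum: "\<not> int m dvd int y + int x"
      proof
        assume "int m dvd int y + int x"
        then have "int m dvd int y + int x - int m" by simp
        then have "int y + int x - int m = 0" by (rule dvd_small) (use g in linarith)
        then show False using g by simp
      qed
      have minus: "int m dvd - k - l \<longleftrightarrow> int m dvd k + l" for k l :: int
      proof -
        have "- k - l = - (k + l)" by simp
        then show ?thesis by (simp only: dvd_minus_iff)
      qed
      have no: "\<not> int m dvd - int x - int x" "\<not> int m dvd - int y - int y"
        "\<not> int m dvd int y - int x" "\<not> int m dvd int x - int y"
        "\<not> int m dvd - int y - int x" "\<not> int m dvd - int x - int y"
        using no_x no_y no_diff no_sum minus dvd_diff_commute[of "int m" "int y" "int x"]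
        unfolding mult_2 by (metis add.commute)+
      have "(p, q, r, s) \<in> {(-1,0,0,1), (1,0,0,-1), (-1,0,0,-1), (0,1,1,0), (0,-1,1,0), (0,1,-1,0), (0,-1,-1,0)}"
        using c by (auto simp: signed_perms_def pqrs)
      then show False using d no by (elim insertE emptyE) simp_all
    qed
  next
    fix u a assume u: "u \<in> generic_vectors P" and a: "a \<in> carrier (plane m)"
      and triv: "\<And>c. c \<in> carrier signed_perms \<Longrightarrow> plane_char m u (mat2_act m c a) = 1"
    obtain x y where xy: "u = (x, y)" by (cases u)
    obtain s t where st: "a = (s, t)" by (cases a)
    have rng: "0 \<le> s" "s < int m" "0 \<le> t" "t < int m" using a by (auto simp: st plane_def)
    have *: "int m dvd (int x * p + int y * r) * s + (int x * q + int y * w) * t"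
      if "(p, q, r, w) \<in> carrier signed_perms" for p q r w
      using triv[OF that] unfolding xy st plane_char_act[OF m0] by (simp add: unity_root_eq_1_iff[OF m0])
    \<comment> \<open>The identity, a reflection, the swap and a rotation of order 4.\<close>
    have d1: "int m dvd int x * s + int y * t" using *[of 1 0 0 1] by (simp add: signed_perms_def)
    have d2: "int m dvd int x * s - int y * t" using *[of 1 0 0 "-1"] by (simp add: signed_perms_def)
    have d3: "int m dvd int y * s + int x * t" using *[of 0 1 1 0] by (simp add: signed_perms_def)
    have d4: "int m dvd int y * s - int x * t" using *[of 0 "-1" 1 0] by (simp add: signed_perms_def)
    have double: "(k + l) + (k - l) = 2 * k" "(k + l) - (k - l) = 2 * l" for k l :: int
      by simp_all
    have xs: "int m dvd int x * s" and yt: "int m dvd int y * t"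
      using dvd_half dvd_add[OF d1 d2] dvd_diff[OF d1 d2] unfolding double by blast+
    have ys: "int m dvd int y * s" and xt: "int m dvd int x * t"
      using dvd_half dvd_add[OF d3 d4] dvd_diff[OF d3 d4] unfolding double by blast+
    have "s = 0" "t = 0"
      using dvd_cancel[OF u[unfolded xy] rng(1,2) xs ys] dvd_cancel[OF u[unfolded xy] rng(3,4) xt yt]
      by blast+
    then show "a = \<one>\<^bsub>plane m\<^esub>" by (simp add: st plane_def)
  qed
  moreover have "real m ^ 4 / 32 \<le> real (m * m) * real (card (generic_vectors P)) / 8"
  proof -
    have "real m ^ 2 / 4 \<le> real (card (generic_vectors P))"
      unfolding m_def by (rule card_generic_vectors[OF fin P m16])
    from mult_left_mono[OF this, of "real m ^ 2"] show ?thesis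
      by (simp add: power2_eq_square power4_eq_xxxx)
  qed
  ultimately show ?thesis by (simp add: card_plane card_signed_perms)
qed

section \<open>The comparison\<close>

(* Every finite group is isomorphic to one whose elements are natural numbers, so taking
   the carrier type to be nat loses no generality. *)
theorem theorem1p5:
  shows "\<exists>(n::nat) (G::nat monoid). n > 0 \<and> group G \<and> finite (carrier G) \<and> Coset.order G = n \<and>
           S_c G > S_c (integer_mod_group n)"
proof -
  obtain P :: "nat set" where fin: "finite P" and P: "\<And>p. p \<in> P \<Longrightarrow> prime p \<and> odd p"
    and big: "\<Prod>P \<ge> 17" and small: "(\<Prod>p\<in>P. 1 - 1 / real p + 1 / real p ^ 2) < 1 / 2048"
    using odd_prime_set_with_small_weight[of "1 / 2048"] by auto
  define m where "m = \<Prod>P"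
  define n where "n = 8 * m\<^sup>2"
  have m: "m > 0" "m \<ge> 16" using big by (auto simp: m_def)
  then have n: "n > 0" by (simp add: n_def)
  interpret semidirect "plane m" signed_perms "mat2_act m" by (rule semidirect_plane[OF m(1)])
  obtain H :: "nat monoid" and h where H: "group H" and h: "h \<in> iso semidirect_product H"
    using finite_group_copy_on_nat[OF group_semidirect_product finite_semidirect_product] by blast
  have bij: "bij_betw h (carrier semidirect_product) (carrier H)" using h by (simp add: iso_def)
  have "finite (carrier H)" using bij_betw_finite[OF bij] finite_semidirect_product by simp
  moreover have "Coset.order H = n"
    using bij_betw_same_card[OF bij]
    by (simp add: Coset.order_def n_def card_cartesian_product card_plane card_signed_perms power2_eq_square)
  moreover have "S_c (integer_mod_group n) < S_c H"
  proof -
    have "\<Prod>P dvd n" by (simp add: n_def m_def power2_eq_square)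
    then have "S_c (integer_mod_group n) \<le> real n ^ 2 * (\<Prod>p\<in>P. 1 - 1 / real p + 1 / real p ^ 2)"
      using S_c_cyclic_le[OF n] sum_div_gcd_le[OF fin _ _ n] P by fastforce
    also have "\<dots> < real n ^ 2 * (1 / 2048)"
      using small n by (intro mult_strict_left_mono) auto
    also have "\<dots> = real m ^ 4 / 32" by (simp add: n_def power2_eq_square power4_eq_xxxx)
    also have "\<dots> \<le> S_c semidirect_product"
      unfolding m_def using m by (intro S_c_semidirect_plane_ge fin P) (auto simp: m_def)
    also have "\<dots> = S_c H" by (rule S_c_iso[OF group_semidirect_product H h])
    finally show ?thesis .
  qed
  ultimately show ?thesis using n H by blast
qed

end
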